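(* Let $\mu=\log 2$ and $\sigma^2=\log 2-\tfrac12$ with $\sigma>0$. The numbers $\{|M_{n,k}|n^k\}_{1\le k\le n}$ satisfy the local limit theorem with parameters $(\mu n,\sigma^2 n)$ and rate $n^{-1/2}$. That is, for $n\ge2$ let $Y_n$ be a random variable with $$\mathbb{P}(Y_n=k)=\frac{|M_{n,k}|n^k}{\sum_{1\le j\le n}|M_{n,j}|n^j}\qquad(1\le k\le n)$$ and $\mathbb P(Y_n=k)=0$ for all other integers $k$. Then, as $n\to\infty$, $\mathbb{E}(Y_n)\sim\mu n$, $\mathbb{V}(Y_n)\sim\sigma^2 n$, and $$\sup_{k\in\mathbb{Z}}\left|\sigma\sqrt{n}\;\mathbb{P}(Y_n=k)-\frac{1}{\sqrt{2\pi}}\exp\left(-\frac{(k-\mu n)^2}{2\sigma^2 n}\right)\right|=O\left(n^{-1/2}\right).$$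
   Context: Let $s_{n,k}$ denote the signed Stirling numbers of the first kind, $\sum_{k} s_{n,k}z^k=z(z-1)\cdots(z-n+1)$. Let $\beta_n:=n![z^n]e^{e^z-1-z}$, the number of set partitions of $n$ labeled elements without singleton blocks (so $\beta_0=1,\beta_1=0,\beta_2=1,\beta_3=1,\beta_4=4$), where $[z^n]f(z)$ is the coefficient of $z^n$ in the Taylor expansion of $f$. The Matsunaga numbers $M_{n,k}$ are defined by the recurrence $M_{n,k}=nM_{n-1,k}+\beta_n s_{n,k}$ for $1\le k\le n$ (with $n\ge 2$), with boundary conditions $M_{n,k}=0$ for $n\le 1$, $k\le 0$ and $k>n$. $\mathbb{E}$ and $\mathbb{V}$ denote mean and variance. *)

theory Defs
  imports
    "HOL-Probability.Probability"
    "HOL-Computational_Algebra.Polynomial"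
    "HOL-Computational_Algebra.Formal_Power_Series"
    "HOL-Library.Landau_Symbols"
begin

definition signed_stirling :: "nat \<Rightarrow> nat \<Rightarrow> int" where
  "signed_stirling n k = coeff (\<Prod>i<n. [:- int i, 1:]) k"

text \<open>The inner series \<open>e\<^sup>z - 1 - z\<close> has zero constant term, so formal composition is legitimate.\<close>

definition no_singleton_bell :: "nat \<Rightarrow> real" where
  "no_singleton_bell n =
     fact n * fps_nth (fps_exp (1::real) oo (fps_exp 1 - 1 - fps_X)) n"

fun matsunaga :: "nat \<Rightarrow> nat \<Rightarrow> real" where
  "matsunaga n k =
     (if n \<le> 1 \<or> k = 0 \<or> n < k then 0
      else real n * matsunaga (n - 1) k + no_singleton_bell n * real_of_int (signed_stirling n k))"

declare matsunaga.simps [simp del]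

text \<open>The remaining facts show that for \<open>n \<ge> 2\<close> the weights \<open>\<bar>matsunaga n k\<bar> * n ^ k\<close> do
  normalise to a probability distribution on the integers.\<close>

lemma no_singleton_bell_pos:
  assumes "n \<ge> 2"
  shows "no_singleton_bell n > 0"
proof -
  let ?g = "fps_exp (1::real) - 1 - fps_X"
  have g: "fps_nth ?g i \<ge> 0" for i
    by (cases "i = 0"; cases "i = 1") (auto simp: fps_X_def)
  have gp: "fps_nth (?g ^ j) i \<ge> 0" for i j
  proof (induction j arbitrary: i)
    case (Suc j)
    then show ?case using g by (auto simp: fps_mult_nth intro!: sum_nonneg mult_nonneg_nonneg)
  qed auto
  have "0 < fps_nth (fps_exp (1::real)) 1 * fps_nth (?g ^ 1) n"
    using assms by (auto simp: fps_X_def)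
  also have "\<dots> \<le> (\<Sum>i=0..n. fps_nth (fps_exp (1::real)) i * fps_nth (?g ^ i) n)"
    using assms gp by (intro member_le_sum) auto
  finally show ?thesis
    by (simp add: no_singleton_bell_def fps_compose_nth)
qed

lemma matsunaga_sum_pos:
  assumes "n \<ge> 2"
  shows "(\<Sum>j=1..n. \<bar>matsunaga n j\<bar> * real n ^ j) > 0"
proof -
  let ?p = "\<Prod>i<n. [:- int i, 1:]"
  have "lead_coeff ?p = 1"
    by (rule trans[OF lead_coeff_prod]) simp
  moreover have "degree ?p = n"
    by (simp add: degree_prod_eq_sum_degree)
  ultimately have "signed_stirling n n = 1"
    unfolding signed_stirling_def by metis
  moreover have "matsunaga (n - 1) n = 0"
    using assms by (subst matsunaga.simps) auto
  ultimately have "matsunaga n n = no_singleton_bell n"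
    using assms by (subst matsunaga.simps) auto
  then have "0 < \<bar>matsunaga n n\<bar> * real n ^ n"
    using no_singleton_bell_pos[OF assms] assms by simp
  also have "\<dots> \<le> (\<Sum>j=1..n. \<bar>matsunaga n j\<bar> * real n ^ j)"
    using assms by (intro member_le_sum) auto
  finally show ?thesis .
qed

lemma matsunaga_distribution_exists:
  assumes "n \<ge> 2"
  shows "\<exists>p :: int pmf.
    (\<forall>k\<in>{1..n}. pmf p (int k) = \<bar>matsunaga n k\<bar> * real n ^ k / (\<Sum>j=1..n. \<bar>matsunaga n j\<bar> * real n ^ j)) \<and>
    (\<forall>k. k \<notin> {1..int n} \<longrightarrow> pmf p k = 0)"
proof -
  define f :: "int \<Rightarrow> real" where
    "f k = (if k \<in> {1..int n}
            then \<bar>matsunaga n (nat k)\<bar> * real n ^ nat k / (\<Sum>j=1..n. \<bar>matsunaga n j\<bar> * real n ^ j) else 0)" for k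
  have nonneg: "f k \<ge> 0" for k
    using matsunaga_sum_pos[OF assms] by (auto simp: f_def)
  have "sum f {1..int n} = (\<Sum>k=1..n. \<bar>matsunaga n k\<bar> * real n ^ k / (\<Sum>j=1..n. \<bar>matsunaga n j\<bar> * real n ^ j))"
    by (rule sum.reindex_bij_witness[of _ int nat]) (auto simp: f_def)
  also have "\<dots> = 1"
    using matsunaga_sum_pos[OF assms]
    by (simp flip: sum_divide_distrib)
  finally have total: "sum f {1..int n} = 1" .
  have "(\<integral>\<^sup>+k. ennreal (f k) \<partial>count_space UNIV) = (\<Sum>k\<in>{1..int n}. ennreal (f k))"
    by (rule nn_integral_count_space') (auto simp: f_def)
  also have "\<dots> = 1"
    using total nonneg by (simp add: sum_ennreal)
  finally have "pmf (embed_pmf f) k = f k" for k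
    using nonneg by (intro pmf_embed_pmf)
  then show ?thesis
    by (intro exI[of _ "embed_pmf f"]) (auto simp: f_def)
qed

end

theory Submission
  imports Defs "HOL-Combinatorics.Stirling" "HOL-Real_Asymp.Real_Asymp"
begin

text \<open>Write \<open>\<beta>\<close> for the numbers of partitions without singletons and \<open>c(n,k)\<close> for the unsigned Stirling
  numbers of the first kind. Since \<open>n \<beta>(n - 1) = O(sqrt n \<beta>(n))\<close> and \<open>c(n - 1,k) \<le> c(n,k) / (n - 1)\<close>, the
  recurrence gives \<open>\<bar>M(n,k)\<bar> = \<beta>(n) c(n,k) (1 + O(1 / sqrt n))\<close> uniformly in \<open>k\<close>. After normalisation,
  \<open>c(n,k) n^k\<close> is the law of a sum of \<open>n\<close> independent Bernoulli variables with success probabilities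
  \<open>n / (n + i)\<close>, \<open>i < n\<close>, because its generating polynomial is the rising factorial of \<open>n z\<close>. For this sum
  mean, variance and a local limit theorem with rate \<open>1 / sqrt n\<close> follow from Fourier inversion, and a
  relative perturbation of order \<open>1 / sqrt n\<close> preserves all three assertions.\<close>

section \<open>Partitions without singletons and Matsunaga numbers\<close>

text \<open>The rate \<open>1 / sqrt n\<close> fixes how crude each step may be. Point probabilities
  are O(1 / sqrt n), so a relative error O(1 / sqrt n), uniform in \<open>k\<close>, stays O(1 /
  sqrt n) after scaling by \<open>sqrt n\<close>. It is thus enough that
  \<open>no_singleton_bell\<close> grows by a factor of order \<open>sqrt n\<close> per step, which
  induction gives. The source term of the recurrence changes sign with \<open>n\<close>, but each
  one dominates everything inherited from earlier steps. The constants come from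
  \<open>p = 1 / (1 + i / n)\<close>: the sums of \<open>p\<close> and \<open>p^2\<close> are
  \<open>n\<close> times Riemann sums of \<open>1 / (1 + x)\<close> and \<open>1 / (1 + x)^2\<close>
  on [0, 1], with integrals \<open>ln 2\<close> and \<open>1 / 2\<close>. Mean and variance are
  therefore \<open>n * ln 2\<close> and \<open>n * (ln 2 - 1 / 2)\<close>, each up to an error of at
  most 1. The Fourier step does not split the period into a centre and tails: on all of it, the
  characteristic function differs from the Gaussian by at most a constant times
  \<open>\<bar>t\<bar> * exp (- (b * t^2 / 2))\<close> with \<open>b\<close> of order
  \<open>n\<close>, and the integral \<open>2 / b\<close> of that bound is already O(1 / n).\<close>

lemma no_singleton_bell_0 [simp]: "no_singleton_bell 0 = 1"
  by (simp add: no_singleton_bell_def)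

text \<open>The series \<open>F = exp (exp z - 1 - z)\<close> satisfies
  \<open>F' = (exp z - 1) * F\<close>. The vanishing constant term of \<open>exp z - 1\<close>
  removes \<open>j = n\<close>: the block of the new element must contain a companion.\<close>

lemma no_singleton_bell_Suc:
  "no_singleton_bell (Suc n) = (\<Sum>j<n. real (n choose j) * no_singleton_bell j)"
proof -
  define f where "f = fps_exp (1::real) oo (fps_exp 1 - 1 - fps_X)"
  have f: "no_singleton_bell j = fact j * fps_nth f j" for j
    by (simp add: no_singleton_bell_def f_def)
  have "fps_deriv f = f * (fps_exp 1 - 1)"
    by (simp add: f_def fps_compose_deriv)
  then have "fps_nth (fps_deriv f) n = (\<Sum>j\<le>n. fps_nth f j * (if j = n then 0 else 1 / fact (n - j)))"
    by (auto simp: fps_mult_nth atLeast0AtMost intro!: sum.cong)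
  also have "\<dots> = (\<Sum>j<n. fps_nth f j / fact (n - j))"
    by (simp add: lessThan_Suc_atMost [symmetric])
  finally have "real (Suc n) * fps_nth f (Suc n) = (\<Sum>j<n. fps_nth f j / fact (n - j))"
    by (simp add: fps_deriv_nth)
  then have "no_singleton_bell (Suc n) = fact n * (\<Sum>j<n. fps_nth f j / fact (n - j))"
    by (simp only: f fact_Suc) (simp add: mult.commute mult.left_commute)
  also have "\<dots> = (\<Sum>j<n. real (n choose j) * no_singleton_bell j)"
    unfolding sum_distrib_left f
    by (intro sum.cong) (auto simp: binomial_fact)
  finally show ?thesis .
qed

lemma no_singleton_bell_1 [simp]: "no_singleton_bell (Suc 0) = 0"
  by (simp add: no_singleton_bell_Suc)

lemma no_singleton_bell_2 [simp]: "no_singleton_bell 2 = 1"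
  using no_singleton_bell_Suc[of 1] by (simp add: numeral_2_eq_2)

lemma no_singleton_bell_nonneg [simp]: "no_singleton_bell n \<ge> 0"
proof (cases "n \<ge> 2")
  case False
  then have "n = 0 \<or> n = Suc 0" by auto
  then show ?thesis by auto
qed (simp add: no_singleton_bell_pos less_imp_le)

text \<open>In the recurrence, the term \<open>j = 2\<close> for \<open>n + 1\<close> pays for the terms \<open>j \<le> 1\<close> for \<open>n\<close>; the other
  terms are compared one by one, \<open>j + 1\<close> for \<open>n + 1\<close> against \<open>j\<close> for \<open>n\<close>.\<close>

lemma no_singleton_bell_growth:
  "n \<ge> 1 \<Longrightarrow> no_singleton_bell (Suc n) \<ge> sqrt (Suc n) / 2 * no_singleton_bell n"
proof (induction n rule: less_induct)
  case (less n)
  consider "n = 1" | "n = 2" | "n \<ge> 3" using less.prems by linarith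
  then show ?case
  proof cases
    case 1
    then show ?thesis by simp
  next
    case 2
    have "no_singleton_bell 3 = 1"
      using no_singleton_bell_Suc[of 2] by (simp add: numeral_2_eq_2 numeral_3_eq_3)
    moreover have "sqrt 3 \<le> 2" by (rule real_le_lsqrt) auto
    ultimately show ?thesis using 2 no_singleton_bell_2 by (simp add: numeral_3_eq_3 numeral_2_eq_2 del: no_singleton_bell_2)
  next
    case 3
    define m where "m = n - 1"
    have m: "n = Suc m" "m \<ge> 2" using 3 by (auto simp: m_def)
    let ?b = no_singleton_bell and ?c = "sqrt (Suc n) / 2"
    have n: "?b n = 1 + (\<Sum>j=2..<m. real (m choose j) * ?b j)"
    proof -
      have "{..<m} = {0, 1} \<union> {2..<m}" using m by auto
      then show ?thesis
        unfolding m(1) no_singleton_bell_Suc by (simp only:) (subst sum.union_disjoint; simp)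
    qed
    have first: "?c \<le> real (n choose 2) * ?b 2"
    proof -
      have "real (n choose 2) \<ge> real n"
        using div_le_mono[of "n * 2" "n * (n - 1)" 2] m by (simp add: choose_two del: mult_Suc)
      moreover have "sqrt (Suc n) \<le> 2 * real n"
        using mult_right_mono[of 3 "real n" "real n"] 3
        by (intro real_le_lsqrt; simp only: power2_eq_square; linarith)
      ultimately show ?thesis by simp
    qed
    have rest: "?c * (real (m choose j) * ?b j) \<le> real (n choose Suc j) * ?b (Suc j)"
      if j: "j \<in> {2..<m}" for j
    proof -
      have IH: "?b (Suc j) \<ge> sqrt (Suc j) / 2 * ?b j"
        using less.IH[of j] j m by auto
      have ch: "real (n choose Suc j) = real n / real (Suc j) * real (m choose j)"
        using Suc_times_binomial_eq[of m j] unfolding m(1)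
        by (simp add: field_simps flip: of_nat_mult)
      \<comment> \<open>The strict range \<open>j < m\<close> gives
        \<open>Suc j \<le> n - 1\<close>, and \<open>(n + 1) * (n - 1) \<le> n^2\<close>. A term
        \<open>j = m\<close>, which the ban on singletons removes, would break this
        inequality.\<close>
      have "sqrt (Suc n) * sqrt (Suc j) \<le> real n"
      proof -
        have "real (Suc n) * real (Suc j) \<le> real (Suc n) * real (n - 1)"
          using j m by (intro mult_left_mono) auto
        also have "\<dots> \<le> (real n)\<^sup>2" using m by (simp add: power2_eq_square algebra_simps)
        finally show ?thesis unfolding real_sqrt_mult[symmetric] by (intro real_le_lsqrt) auto
      qed
      then have "sqrt (Suc n) \<le> real n / sqrt (Suc j)"
        by (simp add: pos_le_divide_eq)
      also have "\<dots> = real n / real (Suc j) * sqrt (Suc j)"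
        by (simp add: field_simps)
      finally have "?c * (real (m choose j) * ?b j)
          \<le> (real n / real (Suc j) * sqrt (Suc j)) / 2 * (real (m choose j) * ?b j)"
        by (intro mult_right_mono divide_right_mono) auto
      also have "\<dots> = real (n choose Suc j) * (sqrt (Suc j) / 2 * ?b j)"
        by (simp add: ch)
      also have "\<dots> \<le> real (n choose Suc j) * ?b (Suc j)"
        by (intro mult_left_mono IH) auto
      finally show ?thesis .
    qed
    have "?c * ?b n = ?c + (\<Sum>j=2..<m. ?c * (real (m choose j) * ?b j))"
      by (simp add: n distrib_left sum_distrib_left)
    also have "\<dots> \<le> real (n choose 2) * ?b 2 + (\<Sum>j=2..<m. real (n choose Suc j) * ?b (Suc j))"
      by (intro add_mono first sum_mono rest)
    also have "(\<Sum>j=2..<m. real (n choose Suc j) * ?b (Suc j)) = (\<Sum>j=3..<n. real (n choose j) * ?b j)"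
      using sum.shift_bounds_Suc_ivl[of "\<lambda>j. real (n choose j) * ?b j" 2 m]
      by (simp add: m(1) del: sum.op_ivl_Suc binomial_Suc_Suc)
    also have "real (n choose 2) * ?b 2 + \<dots> = (\<Sum>j\<in>insert 2 {3..<n}. real (n choose j) * ?b j)"
      by simp
    also have "\<dots> \<le> (\<Sum>j<n. real (n choose j) * ?b j)"
      using 3 by (intro sum_mono2) auto
    finally show ?thesis by (simp add: no_singleton_bell_Suc)
  qed
qed

lemma signed_stirling_eq: "real_of_int (signed_stirling n k) = (- 1) ^ (n + k) * real (stirling n k)"
proof (induction n arbitrary: k)
  case 0
  show ?case by (cases k) (auto simp: signed_stirling_def)
next
  case (Suc n)
  let ?P = "\<Prod>i<n. [:- int i, 1:]"
  have "coeff (?P * [:- int n, 1:]) k = - int n * coeff ?P k + (case k of 0 \<Rightarrow> 0 | Suc j \<Rightarrow> coeff ?P j)"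
    by (simp add: mult.commute[of ?P] coeff_pCons)
  then have "signed_stirling (Suc n) k =
      - int n * signed_stirling n k + (case k of 0 \<Rightarrow> 0 | Suc j \<Rightarrow> signed_stirling n j)"
    by (simp add: signed_stirling_def split: nat.splits)
  then have "real_of_int (signed_stirling (Suc n) k) =
      - real n * signed_stirling n k + (case k of 0 \<Rightarrow> 0 | Suc j \<Rightarrow> signed_stirling n j)"
    by (simp split: nat.splits)
  \<comment> \<open>For \<open>k = 0\<close> the product polynomial yields a multiple of
    \<open>n * stirling n 0\<close>, whereas \<open>stirling (Suc n) 0\<close> is 0 by
    definition.\<close>
  moreover have "real n * real (stirling n 0) = 0" by (cases n) auto
  ultimately show ?case
    by (cases k) (auto simp: Suc.IH algebra_simps)
qed

lemma stirling_pos: "1 \<le> k \<Longrightarrow> k \<le> n \<Longrightarrow> stirling n k > 0"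
proof (induction n arbitrary: k)
  case (Suc n)
  show ?case
  proof (cases "k = Suc n")
    case False
    then obtain j where "k = Suc j" using Suc.prems by (cases k) auto
    then show ?thesis using Suc.prems Suc.IH[of "Suc j"] Suc.IH[of j] False by (cases "j = 0") auto
  qed simp
qed simp

lemma stirling_Suc_ge: "real n * real (stirling n k) \<le> real (stirling (Suc n) k)"
proof (cases k)
  case 0
  then show ?thesis by (cases n) auto
qed auto

lemma matsunaga_Suc:
  assumes "n \<ge> 1" "k \<ge> 1"
  shows "matsunaga (Suc n) k = real (Suc n) * matsunaga n k +
    no_singleton_bell (Suc n) * real_of_int (signed_stirling (Suc n) k)"
proof (cases "k \<le> Suc n")
  case False
  then show ?thesis by (simp add: matsunaga.simps[of _ k] signed_stirling_eq)
qed (use assms in \<open>subst matsunaga.simps; simp\<close>)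

text \<open>A rough first bound, to be fed back into the recurrence. From \<open>n = 20\<close> on
  it reproduces itself: the inherited term is at most half of the bound for \<open>Suc n\<close>,
  and the source term is at most the other half because \<open>K \<ge> 2\<close>. Smaller
  \<open>n\<close> are absorbed into \<open>K\<close>.\<close>

lemma matsunaga_upper: "\<exists>K. \<forall>n\<ge>2. \<forall>k. \<bar>matsunaga n k\<bar> \<le> K * (no_singleton_bell n * stirling n k)"
proof -
  have ex: "\<exists>K. \<forall>n\<in>{2..N}. \<forall>k. \<bar>matsunaga n k\<bar> \<le> K * (no_singleton_bell n * stirling n k)" for N
  proof -
    let ?r = "\<lambda>(n, k). \<bar>matsunaga n k\<bar> / (no_singleton_bell n * stirling n k)"
    \<comment> \<open>The rectangle contains pairs with \<open>k > n\<close>; there the denominator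
      is 0, so the quotient is 0 as well.\<close>
    let ?K = "Max (?r ` ({2..N} \<times> {1..N}))"
    have "\<bar>matsunaga n k\<bar> \<le> ?K * (no_singleton_bell n * stirling n k)" if n: "n \<in> {2..N}" for n k
    proof (cases "1 \<le> k \<and> k \<le> n")
      case True
      then have "?r (n, k) \<le> ?K" using n by (intro Max_ge) auto
      moreover have "no_singleton_bell n * stirling n k > 0"
        using n True stirling_pos[of k n] no_singleton_bell_pos[of n] by auto
      ultimately show ?thesis by (simp add: pos_divide_le_eq)
    next
      case False
      then show ?thesis using n by (cases "k = 0") (auto simp: matsunaga.simps[of n k] matsunaga.simps[of n 0])
    qed
    then show ?thesis by blast
  qed
  obtain K0 where K0: "\<forall>n\<in>{2..20}. \<forall>k. \<bar>matsunaga n k\<bar> \<le> K0 * (no_singleton_bell n * stirling n k)"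
    using ex by blast
  define K where "K = max 2 K0"
  have "\<bar>matsunaga n k\<bar> \<le> K * (no_singleton_bell n * stirling n k)" if "n \<ge> 2" for n k
    using that
  proof (induction n)
    case (Suc n)
    let ?B = "no_singleton_bell (Suc n) * stirling (Suc n) k"
    show ?case
    proof (cases "Suc n \<le> 20 \<or> k = 0")
      case True
      then consider "Suc n \<le> 20" | "k = 0" by blast
      then show ?thesis
      proof cases
        case 1
        then have "\<bar>matsunaga (Suc n) k\<bar> \<le> K0 * ?B" using K0 Suc.prems by auto
        also have "\<dots> \<le> K * ?B" by (intro mult_right_mono) (auto simp: K_def)
        finally show ?thesis .
      next
        case 2
        then show ?thesis by (simp add: matsunaga.simps[of _ 0])
      qed
    next
      case False
      then have n: "n \<ge> 20" "k \<ge> 1" by auto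
      have "real (Suc n) * (no_singleton_bell n * stirling n k) \<le> ?B / 2"
      proof -
        \<comment> \<open>Halving the inherited term requires
          \<open>n * sqrt (n + 1) / 2 \<ge> 2 * (n + 1)\<close>, that is
          \<open>4 * sqrt (n + 1) \<le> n\<close>. This holds from \<open>n = 17\<close> on; 20 is a
          round threshold.\<close>
        have "(16 + real n * 16) \<le> (real n)\<^sup>2"
          using mult_right_mono[of 20 "real n" "real n"] n unfolding power2_eq_square by linarith
        then have sq: "4 * sqrt (Suc n) \<le> real n"
          using real_le_lsqrt[of "real n / 4" "real (Suc n)"] by (simp add: power_divide)
        have "4 * (real (Suc n) * (no_singleton_bell n * stirling n k))
            = (4 * sqrt (Suc n)) * (sqrt (Suc n) * no_singleton_bell n * stirling n k)"
          by (simp add: algebra_simps flip: real_sqrt_mult_self[of "real (Suc n)"])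
        also have "\<dots> \<le> real n * (sqrt (Suc n) * no_singleton_bell n * stirling n k)"
          by (intro mult_right_mono sq) auto
        also have "\<dots> = 2 * ((sqrt (Suc n) / 2 * no_singleton_bell n) * (real n * stirling n k))"
          by simp
        also have "\<dots> \<le> 2 * ?B"
          using no_singleton_bell_growth[of n] stirling_Suc_ge[of n k] n
          by (intro mult_left_mono mult_mono) auto
        finally show ?thesis by linarith
      qed
      then have "K * (real (Suc n) * (no_singleton_bell n * stirling n k)) \<le> K * (?B / 2)"
        by (intro mult_left_mono) (auto simp: K_def)
      moreover have "real (Suc n) * \<bar>matsunaga n k\<bar> \<le> real (Suc n) * (K * (no_singleton_bell n * stirling n k))"
        using n by (intro mult_left_mono Suc.IH) auto
      moreover have "\<bar>matsunaga (Suc n) k\<bar> \<le> real (Suc n) * \<bar>matsunaga n k\<bar> + ?B"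
        using n by (auto simp: matsunaga_Suc signed_stirling_eq abs_mult intro!: order.trans[OF abs_triangle_ineq] order.trans[OF abs_triangle_ineq4])
      moreover have "?B \<le> K * (?B / 2)"
        using mult_right_mono[of 2 K "?B / 2"] by (simp add: K_def)
      ultimately show ?thesis by (simp add: algebra_simps)
    qed
  qed simp
  then show ?thesis by blast
qed

text \<open>As \<open>n * no_singleton_bell (n - 1) = O(sqrt n * no_singleton_bell n)\<close> and
  \<open>stirling (n - 1) k \<le> stirling n k / (n - 1)\<close>, the recurrence is dominated by its last term,
  uniformly in \<open>k\<close>.\<close>

lemma matsunaga_approx:
  "\<exists>C. \<forall>n\<ge>2. \<forall>k. \<bar>\<bar>matsunaga n k\<bar> - no_singleton_bell n * stirling n k\<bar>
      \<le> C / sqrt n * (no_singleton_bell n * stirling n k)"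
proof -
  obtain K where K: "\<And>n k. n \<ge> 2 \<Longrightarrow> \<bar>matsunaga n k\<bar> \<le> K * (no_singleton_bell n * stirling n k)"
    using matsunaga_upper by blast
  have "\<bar>\<bar>matsunaga n k\<bar> - no_singleton_bell n * stirling n k\<bar>
      \<le> 4 * \<bar>K\<bar> / sqrt n * (no_singleton_bell n * stirling n k)" if n2: "n \<ge> 2" for n k
  proof -
    obtain m where m: "n = Suc m" "m \<ge> 1" using n2 by (cases n) auto
    let ?B = "no_singleton_bell (Suc m) * stirling (Suc m) k"
    have diff: "\<bar>\<bar>matsunaga (Suc m) k\<bar> - ?B\<bar> \<le> real (Suc m) * \<bar>matsunaga m k\<bar>"
    proof (cases "k = 0")
      case False
      \<comment> \<open>As \<open>y\<close> is the source term and
        \<open>\<bar>y\<bar> = ?B\<close>, the reverse triangle inequality disposes of all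
        signs.\<close>
      define x y where "x = matsunaga (Suc m) k" and "y = no_singleton_bell (Suc m) * signed_stirling (Suc m) k"
      have "x - y = real (Suc m) * matsunaga m k"
        using m False by (simp add: matsunaga_Suc x_def y_def)
      moreover have "?B = \<bar>y\<bar>"
        by (simp add: signed_stirling_eq abs_mult y_def)
      ultimately show ?thesis
        using abs_triangle_ineq3[of x y] by (simp add: abs_mult flip: x_def)
    qed (simp add: matsunaga.simps[of _ 0])
    have M: "\<bar>matsunaga m k\<bar> \<le> \<bar>K\<bar> * (no_singleton_bell m * stirling m k)"
    proof (cases "m \<ge> 2")
      case True
      show ?thesis
        by (rule order.trans[OF K[OF True]]) (intro mult_right_mono, auto)
    next
      case False
      then show ?thesis by (subst matsunaga.simps) auto
    qed
    have "sqrt (Suc m) * (real (Suc m) * (no_singleton_bell m * stirling m k))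
        = real (Suc m) * ((sqrt (Suc m) * no_singleton_bell m) * stirling m k)"
      by simp
    \<comment> \<open>The constant 4 consists of two factors 2: one from
      \<open>Suc m \<le> 2 * m\<close>, one from the constant \<open>1 / 2\<close> in
      \<open>no_singleton_bell_growth\<close>.\<close>
    also have "\<dots> \<le> (2 * real m) * ((2 * no_singleton_bell (Suc m)) * stirling m k)"
      using no_singleton_bell_growth[of m] m by (intro mult_mono[OF _ mult_right_mono]) auto
    also have "\<dots> = 4 * no_singleton_bell (Suc m) * (real m * stirling m k)"
      by simp
    also have "\<dots> \<le> 4 * no_singleton_bell (Suc m) * stirling (Suc m) k"
      by (intro mult_left_mono stirling_Suc_ge) auto
    finally have "real (Suc m) * (no_singleton_bell m * stirling m k) \<le> 4 * ?B / sqrt (Suc m)"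
      by (simp add: pos_le_divide_eq mult_ac)
    then have "\<bar>K\<bar> * (real (Suc m) * (no_singleton_bell m * stirling m k)) \<le> \<bar>K\<bar> * (4 * ?B / sqrt (Suc m))"
      by (intro mult_left_mono) auto
    moreover have "real (Suc m) * \<bar>matsunaga m k\<bar> \<le> real (Suc m) * (\<bar>K\<bar> * (no_singleton_bell m * stirling m k))"
      by (intro mult_left_mono M) auto
    moreover have "\<bar>K\<bar> * (4 * ?B / sqrt (Suc m)) = 4 * \<bar>K\<bar> / sqrt (Suc m) * ?B"
      by simp
    moreover have "real (Suc m) * (\<bar>K\<bar> * (no_singleton_bell m * stirling m k))
        = \<bar>K\<bar> * (real (Suc m) * (no_singleton_bell m * stirling m k))"
      by simp
    ultimately show ?thesis
      using diff unfolding m(1) by linarith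
  qed
  then show ?thesis by blast
qed

section \<open>Characteristic functions of Bernoulli sums\<close>

text \<open>Taylor's formula bounds \<open>1 - cos t\<close> below by
  \<open>t^2 / 2 - t^4 / 24\<close>, and \<open>t^2 \<le> 10\<close> because
  \<open>pi < 3.15\<close>; this leaves \<open>1/2 - 10/24 = 1/12\<close>. The weak constant buys
  validity up to \<open>\<bar>t\<bar> = pi\<close>.\<close>

lemma one_minus_cos_ge:
  assumes "\<bar>t\<bar> \<le> pi"
  shows "1 - cos t \<ge> t\<^sup>2 / 12"
proof -
  have "cmod (iexp t - (\<Sum>k\<le>3. (\<i> * t) ^ k / fact k)) \<le> \<bar>t\<bar> ^ 4 / 24"
    using iexp_approx1[of t 3] by (simp add: fact_numeral eval_nat_numeral)
  then have "\<bar>Re (iexp t - (\<Sum>k\<le>3. (\<i> * t) ^ k / fact k))\<bar> \<le> \<bar>t\<bar> ^ 4 / 24"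
    using abs_Re_le_cmod order.trans by blast
  moreover have "Re (iexp t - (\<Sum>k\<le>3. (\<i> * t) ^ k / fact k)) = cos t - 1 + t\<^sup>2 / 2"
    by (simp add: numeral_3_eq_3 fact_numeral Re_exp power2_eq_square power3_eq_cube)
  ultimately have 1: "cos t \<le> 1 - t\<^sup>2 / 2 + \<bar>t\<bar> ^ 4 / 24" by linarith
  have "t\<^sup>2 \<le> pi\<^sup>2" using assms by (simp add: abs_le_square_iff[symmetric])
  also have "\<dots> \<le> 3.15\<^sup>2" using pi_approx by (intro power_mono) auto
  finally have "t\<^sup>2 \<le> 10" by (simp add: power2_eq_square)
  then have "t\<^sup>2 * t\<^sup>2 \<le> 10 * t\<^sup>2" by (intro mult_right_mono) auto
  then have "\<bar>t\<bar> ^ 4 \<le> 10 * t\<^sup>2" by (simp add: power2_eq_square power4_eq_xxxx)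
  then show ?thesis using 1 by linarith
qed

text \<open>The squared modulus equals \<open>1 - 2 * p * (1 - p) * (1 - cos t)\<close>, and
  \<open>1 + x \<le> exp x\<close> moves this into an exponent. In a product the variances then add
  up, so Gaussian decay holds on the whole period.\<close>

lemma norm_bernoulli_char_le:
  assumes "0 \<le> p" "p \<le> 1" "\<bar>t\<bar> \<le> pi"
  shows "cmod (1 - of_real p + of_real p * iexp t) \<le> exp (- (p * (1 - p) * t\<^sup>2 / 12))"
proof -
  have "(cmod (1 - of_real p + of_real p * iexp t))\<^sup>2 = (1 - p + p * cos t)\<^sup>2 + (p * sin t)\<^sup>2"
    by (simp add: cmod_power2 Re_exp Im_exp)
  also have "\<dots> = (1 - p)\<^sup>2 + 2 * p * (1 - p) * cos t + p\<^sup>2 * ((sin t)\<^sup>2 + (cos t)\<^sup>2)"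
    by algebra
  also have "\<dots> = 1 + (- (2 * (p * (1 - p)) * (1 - cos t)))"
    by (simp only: sin_cos_squared_add) (simp add: power2_eq_square algebra_simps)
  also have "\<dots> \<le> exp (- (2 * (p * (1 - p)) * (1 - cos t)))"
    by (rule exp_ge_add_one_self)
  also have "\<dots> \<le> exp (- (2 * (p * (1 - p)) * (t\<^sup>2 / 12)))"
    using assms one_minus_cos_ge[of t] by (simp del: times_divide_eq_right) (intro mult_left_mono; simp)
  also have "\<dots> = (exp (- (p * (1 - p) * t\<^sup>2 / 12)))\<^sup>2"
    by (simp flip: exp_double)
  finally show ?thesis by (rule power2_le_imp_le) auto
qed

lemma exp_minus_approx2:
  fixes x :: real
  assumes "x \<ge> 0"
  shows "\<bar>exp (- x) - (1 - x)\<bar> \<le> x\<^sup>2 / 2"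
proof -
  have "exp (- x) \<le> 1 - x + x\<^sup>2 / 2"
  proof (cases "x = 0")
    case False
    obtain s where "exp (- x) = (\<Sum>m<3. (- x) ^ m / fact m) + exp s / fact 3 * (- x) ^ 3"
      using Maclaurin_exp_le[of "- x" 3] by blast
    moreover have "exp s / fact 3 * (- x) ^ 3 \<le> 0"
      using assms by (intro mult_nonneg_nonpos) auto
    ultimately show ?thesis by (simp add: numeral_3_eq_3 power2_eq_square)
  qed simp
  moreover have "1 - x \<le> exp (- x)" using exp_ge_add_one_self[of "- x"] by simp
  ultimately show ?thesis using assms by (auto simp: abs_le_iff)
qed

text \<open>After centring, the factor is the characteristic function of a law with mean 0 and
  variance \<open>p * (1 - p)\<close>, so it agrees with the Gaussian up to second order. The cubic
  remainders have total constant \<open>1/6 + 1/32\<close>, rounded up to 1.\<close>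

lemma bernoulli_char_approx:
  assumes "0 \<le> p" "p \<le> 1" "\<bar>t\<bar> \<le> pi"
  shows "cmod (iexp (- (p * t)) * (1 - of_real p + of_real p * iexp t) - of_real (exp (- (p * (1 - p) * t\<^sup>2 / 2))))
    \<le> \<bar>t\<bar> ^ 3"
proof -
  define R where "R x = iexp x - (1 + \<i> * x - x\<^sup>2 / 2)" for x
  have R: "cmod (R x) \<le> \<bar>x\<bar> ^ 3 / 6" for x
    using iexp_approx1[of x 2]
    by (simp add: R_def fact_numeral eval_nat_numeral power_mult_distrib algebra_simps)
  have R': "cmod (R (q * t)) \<le> \<bar>t\<bar> ^ 3 / 6" if "\<bar>q\<bar> \<le> 1" for q
  proof -
    have "\<bar>q * t\<bar> ^ 3 \<le> (1 * \<bar>t\<bar>) ^ 3"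
      unfolding abs_mult using that by (intro power_mono mult_right_mono) auto
    then have "\<bar>q * t\<bar> ^ 3 \<le> \<bar>t\<bar> ^ 3" by simp
    then show ?thesis using R[of "q * t"] by linarith
  qed
  define v where "v = p * (1 - p)"
  have v: "0 \<le> v" "v \<le> 1 / 4"
    using assms mult_nonneg_nonneg[of p "1 - p"] sum_squares_ge_zero[of "p - 1/2" 0]
    by (auto simp: v_def algebra_simps)
  define S where "S = exp (- (v * t\<^sup>2 / 2)) - (1 - v * t\<^sup>2 / 2)"
  have "\<bar>S\<bar> \<le> (v * t\<^sup>2 / 2)\<^sup>2 / 2"
    unfolding S_def using v by (intro exp_minus_approx2) auto
  also have "\<dots> = v\<^sup>2 / 8 * \<bar>t\<bar> * \<bar>t\<bar> ^ 3"
    by (simp add: power2_eq_square power3_eq_cube)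
  \<comment> \<open>One factor \<open>\<bar>t\<bar>\<close> is traded for \<open>pi < 4\<close>, so
    that the quartic remainder fits the cubic bound.\<close>
  also have "\<dots> \<le> (1/4)\<^sup>2 / 8 * 4 * \<bar>t\<bar> ^ 3"
    using v assms pi_less_4 by (intro mult_right_mono mult_mono divide_right_mono power_mono) auto
  finally have S: "\<bar>S\<bar> \<le> \<bar>t\<bar> ^ 3 / 32" by (simp add: power2_eq_square)
  have "iexp (- (p * t)) * (1 - of_real p + of_real p * iexp t)
      = of_real (1 - p) * iexp (- p * t) + of_real p * iexp ((1 - p) * t)"
    by (simp add: algebra_simps exp_add exp_diff exp_minus field_simps)
  also have "\<dots> - of_real (exp (- (v * t\<^sup>2 / 2)))
     = of_real (1 - p) * R (- p * t) + of_real p * R ((1 - p) * t) - of_real S"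
    by (simp add: R_def S_def v_def power2_eq_square field_simps)
  also have "cmod \<dots> \<le> cmod (of_real (1 - p) * R (- p * t)) + cmod (of_real p * R ((1 - p) * t)) + cmod (of_real S)"
    by (intro order.trans[OF norm_triangle_ineq4] add_mono norm_triangle_ineq order.refl)
  also have "\<dots> = (1 - p) * cmod (R (- p * t)) + p * cmod (R ((1 - p) * t)) + \<bar>S\<bar>"
    using assms unfolding norm_mult norm_of_real by simp
  also have "\<dots> \<le> (1 - p) * (\<bar>t\<bar> ^ 3 / 6) + p * (\<bar>t\<bar> ^ 3 / 6) + \<bar>t\<bar> ^ 3 / 32"
    using assms by (intro add_mono mult_left_mono R' S) auto
  also have "\<dots> = (1 / 6 + 1 / 32) * \<bar>t\<bar> ^ 3" by (simp add: field_simps)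
  also have "\<dots> \<le> 1 * \<bar>t\<bar> ^ 3" by (intro mult_right_mono) auto
  also have "\<dots> = \<bar>t\<bar> ^ 3" by simp
  finally show ?thesis by (simp add: v_def)
qed

text \<open>The factors are multiplied by \<open>exp (p i * (1 - p i) * t\<^sup>2 / 12)\<close>, which still leaves them in the
  unit disc; this saves the Gaussian decay that the plain telescoping bound would lose.\<close>

lemma bernoulli_prod_char_approx:
  fixes p :: "'i \<Rightarrow> real" and t :: real
  assumes "\<And>i. i \<in> I \<Longrightarrow> 0 \<le> p i \<and> p i \<le> 1" "\<bar>t\<bar> \<le> pi"
  defines "m \<equiv> (\<Sum>i\<in>I. p i)" and "V \<equiv> (\<Sum>i\<in>I. p i * (1 - p i))"
  shows "cmod (iexp (- (m * t)) * (\<Prod>i\<in>I. 1 - of_real (p i) + of_real (p i) * iexp t)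
      - of_real (exp (- (V * t\<^sup>2 / 2)))) \<le> 3 * card I * \<bar>t\<bar> ^ 3 * exp (- (V * t\<^sup>2 / 12))"
proof (cases "finite I")
  \<comment> \<open>For infinite \<open>I\<close> the sums and \<open>card I\<close> are 0 and the
    product is 1, so both sides are 0.\<close>
  case False
  then show ?thesis by (simp add: m_def V_def)
next
  case True
  define v where "v i = p i * (1 - p i)" for i
  have v: "0 \<le> v i" "v i \<le> 1 / 4" if "i \<in> I" for i
    using assms(1)[OF that] mult_nonneg_nonneg[of "p i" "1 - p i"] sum_squares_ge_zero[of "p i - 1/2" 0]
    by (auto simp: v_def algebra_simps)
  have t2: "t\<^sup>2 \<le> 16"
    using power_mono[of "\<bar>t\<bar>" 4 2] assms(2) pi_less_4 by simp
  define z where "z i = of_real (exp (v i * t\<^sup>2 / 12)) *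
      (iexp (- (p i * t)) * (1 - of_real (p i) + of_real (p i) * iexp t))" for i
  define w where "w i = complex_of_real (exp (v i * t\<^sup>2 / 12) * exp (- (v i * t\<^sup>2 / 2)))" for i
  have z: "cmod (z i) \<le> 1" if "i \<in> I" for i
  proof -
    have "cmod (z i) = exp (v i * t\<^sup>2 / 12) * cmod (1 - of_real (p i) + of_real (p i) * iexp t)"
      by (simp add: z_def norm_mult)
    also have "\<dots> \<le> exp (v i * t\<^sup>2 / 12) * exp (- (v i * t\<^sup>2 / 12))"
      using assms(1)[OF that] assms(2) norm_bernoulli_char_le[of "p i" t]
      by (intro mult_left_mono) (auto simp: v_def)
    finally show ?thesis by (simp flip: exp_add)
  qed
  have w: "cmod (w i) \<le> 1" if "i \<in> I" for i
    using v[OF that] by (simp add: w_def norm_mult flip: exp_add)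
  have diff: "cmod (z i - w i) \<le> 3 * \<bar>t\<bar> ^ 3" if "i \<in> I" for i
  proof -
    have "z i - w i = of_real (exp (v i * t\<^sup>2 / 12)) *
      (iexp (- (p i * t)) * (1 - of_real (p i) + of_real (p i) * iexp t) - of_real (exp (- (v i * t\<^sup>2 / 2))))"
      by (simp add: z_def w_def right_diff_distrib)
    then have "cmod (z i - w i) = exp (v i * t\<^sup>2 / 12) *
      cmod (iexp (- (p i * t)) * (1 - of_real (p i) + of_real (p i) * iexp t) - of_real (exp (- (v i * t\<^sup>2 / 2))))"
      by (simp only: norm_mult norm_of_real abs_exp_cancel)
    also have "\<dots> \<le> exp 1 * \<bar>t\<bar> ^ 3"
    proof (intro mult_mono)
      have "v i * t\<^sup>2 \<le> 1/4 * 16" using v[OF that] t2 by (intro mult_mono) auto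
      then show "exp (v i * t\<^sup>2 / 12) \<le> exp 1" by simp
    qed (use assms(1)[OF that] assms(2) bernoulli_char_approx[of "p i" t] in \<open>auto simp: v_def\<close>)
    also have "\<dots> \<le> 3 * \<bar>t\<bar> ^ 3"
      using exp_le by (intro mult_right_mono) auto
    finally show ?thesis .
  qed
  have "iexp (- (m * t)) = (\<Prod>i\<in>I. iexp (- (p i * t)))"
    using True by (simp add: m_def sum_distrib_right sum_distrib_left flip: sum_negf exp_sum)
  moreover have eV: "exp (V * t\<^sup>2 / 12) = (\<Prod>i\<in>I. exp (v i * t\<^sup>2 / 12))"
    using True by (simp add: V_def v_def sum_distrib_right sum_divide_distrib flip: exp_sum)
  moreover have eV': "exp (- (V * t\<^sup>2 / 2)) = (\<Prod>i\<in>I. exp (- (v i * t\<^sup>2 / 2)))"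
    using True by (simp add: V_def v_def sum_distrib_right sum_divide_distrib flip: sum_negf exp_sum)
  ultimately have "(\<Prod>i\<in>I. z i) = of_real (exp (V * t\<^sup>2 / 12)) * (iexp (- (m * t)) * (\<Prod>i\<in>I. 1 - of_real (p i) + of_real (p i) * iexp t))"
    by (simp only: z_def prod.distrib of_real_prod)
  moreover have "(\<Prod>i\<in>I. w i) = of_real (exp (V * t\<^sup>2 / 12)) * of_real (exp (- (V * t\<^sup>2 / 2)))"
    using eV eV' by (simp only: w_def of_real_mult prod.distrib of_real_prod)
  moreover have "cmod ((\<Prod>i\<in>I. z i) - (\<Prod>i\<in>I. w i)) \<le> (\<Sum>i\<in>I. cmod (z i - w i))"
    by (intro norm_prod_diff z w)
  ultimately have "exp (V * t\<^sup>2 / 12) * cmod (iexp (- (m * t)) * (\<Prod>i\<in>I. 1 - of_real (p i) + of_real (p i) * iexp t)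
      - of_real (exp (- (V * t\<^sup>2 / 2)))) \<le> (\<Sum>i\<in>I. cmod (z i - w i))"
    by (simp only: norm_mult norm_of_real abs_exp_cancel flip: right_diff_distrib)
  also have "\<dots> \<le> card I * (3 * \<bar>t\<bar> ^ 3)"
    using sum_bounded_above[of I "\<lambda>i. cmod (z i - w i)", OF diff] by simp
  finally show ?thesis
    by (simp add: exp_minus field_simps)
qed

section \<open>Local limit theorem for Bernoulli sums\<close>

lemma integral_iexp_int:
  "has_bochner_integral lborel (\<lambda>t. indicator {- pi..pi} t *\<^sub>R iexp (of_int m * t))
    (if m = 0 then 2 * of_real pi else 0)"
proof (cases "m = 0")
  case True
  have "has_bochner_integral lborel (\<lambda>t. indicator {- pi..pi} t *\<^sub>R (1::complex)) (of_real pi - of_real (- pi))"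
    by (rule has_bochner_integral_FTC_Icc[where F = complex_of_real])
      (auto intro!: derivative_eq_intros simp: has_vector_derivative_def scaleR_conv_of_real)
  then show ?thesis using True by simp
next
  case False
  have "iexp (of_int m * pi) = iexp (of_int m * (- pi)) * exp (2 * of_int m * of_real pi * \<i>)"
    unfolding exp_add[symmetric] by (rule arg_cong[where f = exp]) (simp add: algebra_simps)
  moreover have "exp (2 * of_int m * of_real pi * \<i>) = (1::complex)"
    using exp_2pi_1_int[of m] by (simp only: mult_ac)
  ultimately have eq: "iexp (of_int m * pi) = iexp (of_int m * (- pi))"
    by (simp only: mult_1_right)
  have "has_bochner_integral lborel (\<lambda>t. indicator {- pi..pi} t *\<^sub>R iexp (of_int m * t))
    (iexp (of_int m * pi) / (\<i> * of_int m) - iexp (of_int m * (- pi)) / (\<i> * of_int m))"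
  proof (rule has_bochner_integral_FTC_Icc[where F = "\<lambda>t. iexp (of_int m * t) / (\<i> * of_int m)"])
    fix t :: real
    have "((\<lambda>z. exp (\<i> * (of_int m * z)) / (\<i> * of_int m)) has_field_derivative exp (\<i> * (of_int m * of_real t))) (at (of_real t))"
      using False by (auto intro!: derivative_eq_intros simp: mult_ac)
    then show "((\<lambda>t. iexp (of_int m * t) / (\<i> * of_int m)) has_vector_derivative iexp (of_int m * t)) (at t within {- pi..pi})"
      using field_vector_diff_chain_at[of of_real 1 t]
      by (auto dest!: has_vector_derivative_real_field[where f="\<lambda>z. exp (\<i> * (of_int m * z)) / (\<i> * of_int m)"] intro: has_vector_derivative_at_within)
  qed (auto intro!: continuous_intros)
  then show ?thesis using False eq by simp
qed

lemma integral_gaussian_iexp: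
  assumes "s > 0"
  shows "integrable lborel (\<lambda>t. iexp (x * t) * of_real (exp (- (s\<^sup>2 * t\<^sup>2 / 2))))"
    and "(\<integral>t. iexp (x * t) * of_real (exp (- (s\<^sup>2 * t\<^sup>2 / 2))) \<partial>lborel)
      = of_real (sqrt (2 * pi) / s * exp (- (x\<^sup>2 / (2 * s\<^sup>2))))"
proof -
  let ?f = "\<lambda>y. std_normal_density y *\<^sub>R iexp (x / s * y)"
  have int: "integrable lborel ?f"
  proof (rule Bochner_Integration.integrable_bound)
    show "integrable lborel std_normal_density" by simp
  qed (auto intro!: borel_measurable_scaleR)
  have val: "(\<integral>y. ?f y \<partial>lborel) = of_real (exp (- ((x / s)\<^sup>2 / 2)))"
    using fun_cong[OF char_std_normal_distribution, of "x / s"]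
    by (simp add: char_def integral_density)
  have eq: "?f (0 + s * t) = (1 / sqrt (2 * pi)) *\<^sub>R (iexp (x * t) * of_real (exp (- (s\<^sup>2 * t\<^sup>2 / 2))))" for t
    using assms by (simp add: std_normal_density_def power_mult_distrib scaleR_conv_of_real)
  have "integrable lborel (\<lambda>t. sqrt (2 * pi) *\<^sub>R ?f (0 + s * t))"
    using assms by (intro integrable_scaleR_right lborel_integrable_real_affine int) auto
  then show "integrable lborel (\<lambda>t. iexp (x * t) * of_real (exp (- (s\<^sup>2 * t\<^sup>2 / 2))))"
    unfolding eq by simp
  have "of_real (exp (- ((x / s)\<^sup>2 / 2))) = s *\<^sub>R (\<integral>t. ?f (0 + s * t) \<partial>lborel)"
    using lborel_integral_real_affine[of s ?f 0] val assms by simp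
  also have "\<dots> = (s / sqrt (2 * pi)) *\<^sub>R (\<integral>t. iexp (x * t) * of_real (exp (- (s\<^sup>2 * t\<^sup>2 / 2))) \<partial>lborel)"
    unfolding eq by simp
  finally show "(\<integral>t. iexp (x * t) * of_real (exp (- (s\<^sup>2 * t\<^sup>2 / 2))) \<partial>lborel)
      = of_real (sqrt (2 * pi) / s * exp (- (x\<^sup>2 / (2 * s\<^sup>2))))"
    using assms by (simp add: scaleR_conv_of_real field_simps power_divide)
qed

text \<open>Up to normalisation this is the first absolute moment of the centred normal law of
  variance \<open>1 / b\<close>. It is why an error with a factor \<open>\<bar>t\<bar>\<close>
  integrates to order \<open>1 / b\<close> and not \<open>1 / sqrt b\<close>.\<close>

lemma integral_abs_gaussian:
  fixes b :: real
  assumes "b > 0"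
  shows "has_bochner_integral lborel (\<lambda>t. \<bar>t\<bar> * exp (- (b * t\<^sup>2 / 2))) (2 / b)"
proof -
  define s where "s = 1 / sqrt b"
  have s: "s > 0" "s\<^sup>2 = 1 / b" using assms by (auto simp: s_def power_divide)
  have "has_bochner_integral lborel (\<lambda>t. (sqrt (2 * pi) * s) * (normal_density 0 s t * \<bar>t - 0\<bar> ^ (2 * 0 + 1)))
     ((sqrt (2 * pi) * s) * (2 ^ 0 * s ^ (2 * 0 + 1) * fact 0 * sqrt (2 / pi)))"
    by (intro has_bochner_integral_mult_right normal_moment_abs_odd s(1))
  also have "(\<lambda>t. (sqrt (2 * pi) * s) * (normal_density 0 s t * \<bar>t - 0\<bar> ^ (2 * 0 + 1)))
     = (\<lambda>t. \<bar>t\<bar> * exp (- (b * t\<^sup>2 / 2)))"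
  proof
    fix t
    have "sqrt (2 * pi * s\<^sup>2) = sqrt (2 * pi) * s" using s(1) by (simp add: real_sqrt_mult)
    moreover have "t\<^sup>2 / (2 * s\<^sup>2) = b * t\<^sup>2 / 2" using s(2) by simp
    ultimately show "(sqrt (2 * pi) * s) * (normal_density 0 s t * \<bar>t - 0\<bar> ^ (2 * 0 + 1)) = \<bar>t\<bar> * exp (- (b * t\<^sup>2 / 2))"
      using s(1) by (simp add: normal_density_def)
  qed
  also have "(sqrt (2 * pi) * s) * (2 ^ 0 * s ^ (2 * 0 + 1) * fact 0 * sqrt (2 / pi)) = sqrt (2 * pi * (2 / pi)) * s\<^sup>2"
    unfolding real_sqrt_mult by (simp add: power2_eq_square)
  also have "\<dots> = 2 / b" using s by simp
  finally show ?thesis .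
qed

text \<open>Fourier inversion on both sides; beyond \<open>\<bar>t\<bar> = pi\<close> the bound on the integrand also
  covers the tail of the Gaussian.\<close>

lemma lattice_local_limit:
  fixes a :: "nat \<Rightarrow> real" and s b C \<mu> :: real and k :: int
  assumes s: "s > 0" and b: "b > 0" "b \<le> s\<^sup>2" and C: "C \<ge> 1"
    and char: "\<And>t. \<bar>t\<bar> \<le> pi \<Longrightarrow>
      cmod (iexp (- (\<mu> * t)) * (\<Sum>j\<le>N. of_real (a j) * iexp (real j * t)) - of_real (exp (- (s\<^sup>2 * t\<^sup>2 / 2))))
        \<le> C * (\<bar>t\<bar> * exp (- (b * t\<^sup>2 / 2)))"
  shows "\<bar>(if 0 \<le> k \<and> k \<le> int N then a (nat k) else 0)
     - 1 / (s * sqrt (2 * pi)) * exp (- ((of_int k - \<mu>)\<^sup>2 / (2 * s\<^sup>2)))\<bar> \<le> C / (pi * b)"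
proof -
  define A where "A = (if 0 \<le> k \<and> k \<le> int N then a (nat k) else 0)"
  define x where "x = \<mu> - of_int k"
  define F where "F t = (\<Sum>j\<le>N. of_real (a j) * (indicator {- pi..pi} t *\<^sub>R iexp (of_int (int j - k) * t)))" for t
  define G where "G t = iexp (x * t) * of_real (exp (- (s\<^sup>2 * t\<^sup>2 / 2)))" for t
  have F: "has_bochner_integral lborel F (\<Sum>j\<le>N. of_real (a j) * (if int j - k = 0 then 2 * of_real pi else 0))"
    unfolding F_def by (intro has_bochner_integral_sum has_bochner_integral_mult_right integral_iexp_int)
  have "(\<Sum>j\<le>N. of_real (a j) * (if int j - k = 0 then 2 * complex_of_real pi else 0)) = 2 * of_real pi * of_real A"
  proof (cases "0 \<le> k \<and> k \<le> int N")
    case True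
    have "(\<Sum>j\<le>N. of_real (a j) * (if int j - k = 0 then 2 * complex_of_real pi else 0))
       = (\<Sum>j\<in>{nat k}. of_real (a j) * (if int j - k = 0 then 2 * complex_of_real pi else 0))"
      using True by (intro sum.mono_neutral_right) auto
    then show ?thesis using True by (simp add: A_def)
  next
    case False
    then show ?thesis by (auto simp: A_def intro!: sum.neutral)
  qed
  with F have F: "has_bochner_integral lborel F (2 * of_real pi * of_real A)" by simp
  have G: "has_bochner_integral lborel G (of_real (sqrt (2 * pi) / s * exp (- (x\<^sup>2 / (2 * s\<^sup>2)))))"
    unfolding G_def has_bochner_integral_iff using integral_gaussian_iexp[OF s] by blast
  define B where "B t = C * (\<bar>t\<bar> * exp (- (b * t\<^sup>2 / 2)))" for t
  have B: "has_bochner_integral lborel B (C * (2 / b))"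
    unfolding B_def by (intro has_bochner_integral_mult_right integral_abs_gaussian b)
  have bound: "cmod (F t - G t) \<le> B t" for t
  proof (cases "\<bar>t\<bar> \<le> pi")
    case True
    have "F t - G t = iexp (x * t) * (iexp (- (\<mu> * t)) * (\<Sum>j\<le>N. of_real (a j) * iexp (real j * t))
       - of_real (exp (- (s\<^sup>2 * t\<^sup>2 / 2))))"
      using True unfolding F_def G_def x_def right_diff_distrib sum_distrib_left
      by (auto simp: algebra_simps exp_add exp_diff exp_minus field_simps intro!: sum.cong)
    also have "cmod \<dots> = cmod (iexp (- (\<mu> * t)) * (\<Sum>j\<le>N. of_real (a j) * iexp (real j * t))
       - of_real (exp (- (s\<^sup>2 * t\<^sup>2 / 2))))"
      by (simp only: norm_mult norm_exp_i_times mult_1)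
    also have "\<dots> \<le> B t" unfolding B_def by (rule char[OF True])
    finally show ?thesis .
  next
    case False
    then have "F t = 0" by (auto simp: F_def indicator_def)
    then have "cmod (F t - G t) = exp (- (s\<^sup>2 * t\<^sup>2 / 2))"
      by (simp add: G_def norm_mult)
    also have "\<dots> \<le> exp (- (b * t\<^sup>2 / 2))"
      using b by (simp add: mult_right_mono)
    also have "\<dots> \<le> (C * \<bar>t\<bar>) * exp (- (b * t\<^sup>2 / 2))"
      using C False pi_gt3 mult_mono[of 1 C 1 "\<bar>t\<bar>"] by simp
    finally show ?thesis by (simp add: B_def)
  qed
  have FG: "has_bochner_integral lborel (\<lambda>t. F t - G t)
     (2 * of_real pi * of_real A - of_real (sqrt (2 * pi) / s * exp (- (x\<^sup>2 / (2 * s\<^sup>2)))))"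
    by (intro has_bochner_integral_diff F G)
  have "cmod (\<integral>t. F t - G t \<partial>lborel) \<le> (\<integral>t. B t \<partial>lborel)"
    using FG B bound
    by (intro Bochner_Integration.integral_norm_bound_integral) (auto simp: has_bochner_integral_iff)
  then have "cmod (of_real (2 * pi * A - sqrt (2 * pi) / s * exp (- (x\<^sup>2 / (2 * s\<^sup>2))))) \<le> C * 2 / b"
    using FG B by (simp add: has_bochner_integral_iff)
  then have "\<bar>2 * pi * A - sqrt (2 * pi) / s * exp (- (x\<^sup>2 / (2 * s\<^sup>2)))\<bar> \<le> C * 2 / b"
    by (simp only: norm_of_real)
  also have "2 * pi * A - sqrt (2 * pi) / s * exp (- (x\<^sup>2 / (2 * s\<^sup>2)))
     = 2 * pi * (A - 1 / (s * sqrt (2 * pi)) * exp (- (x\<^sup>2 / (2 * s\<^sup>2))))"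
    using s real_sqrt_mult_self[of "2 * pi"] by (simp add: field_simps)
  finally have "2 * pi * \<bar>A - 1 / (s * sqrt (2 * pi)) * exp (- (x\<^sup>2 / (2 * s\<^sup>2)))\<bar> \<le> C * 2 / b"
    by (simp only: abs_mult) simp
  then have "\<bar>A - 1 / (s * sqrt (2 * pi)) * exp (- (x\<^sup>2 / (2 * s\<^sup>2)))\<bar> \<le> C / (pi * b)"
    using b by (simp add: field_simps)
  moreover have "x\<^sup>2 = (of_int k - \<mu>)\<^sup>2" by (simp add: x_def power2_commute)
  ultimately show ?thesis by (simp add: A_def)
qed

text \<open>The tolerance 1 lets \<open>\<mu>\<close> and \<open>s^2\<close> be simple main terms
  instead of the exact mean and variance; at frequency \<open>t\<close> it costs factors of order
  \<open>\<bar>t\<bar>\<close> and \<open>t^2\<close> only. The cubic error of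
  \<open>bernoulli_prod_char_approx\<close> is brought to first order by spending half of its
  Gaussian decay on \<open>s^2 * t^2\<close>. The factor 12 reflects the remaining decay
  \<open>b = s^2 / 12\<close>.\<close>

lemma bernoulli_local_limit:
  fixes a :: "nat \<Rightarrow> real" and p :: "'i \<Rightarrow> real" and s \<mu> K :: real and k :: int
  assumes pgf: "\<And>z::complex. (\<Sum>j\<le>N. of_real (a j) * z ^ j) = (\<Prod>i\<in>I. 1 - of_real (p i) + of_real (p i) * z)"
    and p: "\<And>i. i \<in> I \<Longrightarrow> 0 \<le> p i \<and> p i \<le> 1"
    and s: "s > 0" and K: "real (card I) \<le> K * s\<^sup>2"
    and mean: "\<bar>(\<Sum>i\<in>I. p i) - \<mu>\<bar> \<le> 1"
    and var: "\<bar>(\<Sum>i\<in>I. p i * (1 - p i)) - s\<^sup>2\<bar> \<le> 1"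
  shows "\<bar>(if 0 \<le> k \<and> k \<le> int N then a (nat k) else 0)
     - 1 / (s * sqrt (2 * pi)) * exp (- ((of_int k - \<mu>)\<^sup>2 / (2 * s\<^sup>2)))\<bar> \<le> 12 * (648 * K + 2 * exp 8 + 1) / (pi * s\<^sup>2)"
proof -
  define C where "C = 648 * K + 2 * exp 8 + 1"
  define m where "m = (\<Sum>i\<in>I. p i)"
  define V where "V = (\<Sum>i\<in>I. p i * (1 - p i))"
  have "K \<ge> 0" using K s by (metis linordered_field_no_ub mult_less_0_iff not_less of_nat_0_le_iff order.trans zero_less_power)
  then have C: "C \<ge> 1" by (simp add: C_def)
  have "cmod (iexp (- (\<mu> * t)) * (\<Sum>j\<le>N. of_real (a j) * iexp (real j * t)) - of_real (exp (- (s\<^sup>2 * t\<^sup>2 / 2))))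
        \<le> C * (\<bar>t\<bar> * exp (- (s\<^sup>2 / 12 * t\<^sup>2 / 2)))" (is "?L \<le> _") if t: "\<bar>t\<bar> \<le> pi" for t
  proof -
    define P where "P = (\<Prod>i\<in>I. 1 - of_real (p i) + of_real (p i) * iexp t)"
    define e where "e = exp (- (s\<^sup>2 * t\<^sup>2 / 24))"
    have t4: "\<bar>t\<bar> \<le> 4" using t pi_less_4 by linarith
    have t2: "t\<^sup>2 \<le> 16"
      using power_mono[of "\<bar>t\<bar>" 4 2] t4 by simp
    have Vt: "\<bar>V * t\<^sup>2 - s\<^sup>2 * t\<^sup>2\<bar> \<le> t\<^sup>2"
    proof -
      have "\<bar>V - s\<^sup>2\<bar> * \<bar>t\<^sup>2\<bar> \<le> 1 * \<bar>t\<^sup>2\<bar>"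
        using var by (intro mult_right_mono) (auto simp: V_def)
      then show ?thesis by (simp only: abs_mult[symmetric] left_diff_distrib) simp
    qed
    have "(\<Sum>j\<le>N. of_real (a j) * iexp (real j * t)) = P"
      using pgf[of "iexp t"] by (simp add: P_def mult_ac flip: exp_of_nat_mult)
    \<comment> \<open>The three errors: the product against its own Gaussian, \<open>V\<close>
      replaced by \<open>s^2\<close>, and \<open>m\<close> replaced by \<open>\<mu>\<close>.\<close>
    then have "iexp (- (\<mu> * t)) * (\<Sum>j\<le>N. of_real (a j) * iexp (real j * t)) - of_real (exp (- (s\<^sup>2 * t\<^sup>2 / 2)))
      = iexp ((m - \<mu>) * t) * (iexp (- (m * t)) * P - of_real (exp (- (V * t\<^sup>2 / 2))))
        + iexp ((m - \<mu>) * t) * of_real (exp (- (V * t\<^sup>2 / 2)) - exp (- (s\<^sup>2 * t\<^sup>2 / 2)))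
        + (iexp ((m - \<mu>) * t) - 1) * of_real (exp (- (s\<^sup>2 * t\<^sup>2 / 2)))"
      by (simp add: algebra_simps flip: exp_add)
    then have "?L \<le> cmod (iexp (- (m * t)) * P - of_real (exp (- (V * t\<^sup>2 / 2))))
        + \<bar>exp (- (V * t\<^sup>2 / 2)) - exp (- (s\<^sup>2 * t\<^sup>2 / 2))\<bar>
        + cmod (iexp ((m - \<mu>) * t) - 1) * exp (- (s\<^sup>2 * t\<^sup>2 / 2))"
      by (simp only:) (rule norm_triangle_le add_mono order.refl | simp only: norm_mult norm_exp_i_times norm_of_real mult_1 abs_exp_cancel order.refl)+
    moreover have "cmod (iexp (- (m * t)) * P - of_real (exp (- (V * t\<^sup>2 / 2)))) \<le> 648 * K * (\<bar>t\<bar> * e)"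
    proof -
      \<comment> \<open>Here \<open>648 = 3 * 9 * 24\<close>: 3 comes from
        \<open>bernoulli_prod_char_approx\<close>, 9 bounds \<open>exp 2\<close>, which pays for the
        error \<open>t^2 / 12 \<le> 2\<close> in the exponent, and 24 is the denominator of
        \<open>x\<close>. Then \<open>x \<le> exp x\<close> uses up half of
        \<open>exp (- (2 * x))\<close>.\<close>
      define x where "x = s\<^sup>2 * t\<^sup>2 / 24"
      have "cmod (iexp (- (m * t)) * P - of_real (exp (- (V * t\<^sup>2 / 2)))) \<le> 3 * card I * \<bar>t\<bar> ^ 3 * exp (- (V * t\<^sup>2 / 12))"
        unfolding m_def P_def V_def using p t by (intro bernoulli_prod_char_approx) auto
      also have "\<dots> \<le> 3 * (K * s\<^sup>2) * \<bar>t\<bar> ^ 3 * (9 * exp (- (2 * x)))"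
      proof -
        have "exp (- (V * t\<^sup>2 / 12)) \<le> exp (2 + - (2 * x))"
          using Vt t2 by (simp add: x_def)
        also have "\<dots> = exp 1 * exp 1 * exp (- (2 * x))" by (simp flip: exp_add)
        also have "\<dots> \<le> 3 * 3 * exp (- (2 * x))"
          using exp_le by (intro mult_right_mono mult_mono) auto
        finally show ?thesis using K \<open>K \<ge> 0\<close>
          by (intro mult_mono mult_right_mono) auto
      qed
      also have "\<dots> = 648 * K * (\<bar>t\<bar> * (x * exp (- (2 * x))))"
        by (simp add: x_def power3_eq_cube power2_eq_square field_simps)
      also have "\<dots> \<le> 648 * K * (\<bar>t\<bar> * (exp x * exp (- (2 * x))))"
      proof (intro mult_left_mono mult_right_mono)
        show "x \<le> exp x" using exp_ge_add_one_self[of x] by linarith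
      qed (use \<open>K \<ge> 0\<close> in auto)
      also have "exp x * exp (- (2 * x)) = e"
        by (simp add: e_def x_def flip: exp_add)
      finally show ?thesis .
    qed
    moreover have "\<bar>exp (- (V * t\<^sup>2 / 2)) - exp (- (s\<^sup>2 * t\<^sup>2 / 2))\<bar> \<le> 2 * exp 8 * (\<bar>t\<bar> * e)"
    proof -
      have lip: "\<bar>exp (- x) - exp (- y)\<bar> \<le> \<bar>x - y\<bar> * exp (- min x y)" for x y :: real
      proof (induction x y rule: linorder_wlog)
        case (le x y)
        have "1 - exp (- (y - x)) \<le> y - x" using exp_ge_add_one_self[of "- (y - x)"] by linarith
        then have "exp (- x) * (1 - exp (- (y - x))) \<le> exp (- x) * (y - x)" by (intro mult_left_mono) auto
        then show ?case using le by (simp add: min_def right_diff_distrib mult_ac flip: exp_add)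
      qed (simp add: abs_minus_commute min.commute)
      have "\<bar>exp (- (V * t\<^sup>2 / 2)) - exp (- (s\<^sup>2 * t\<^sup>2 / 2))\<bar>
        \<le> \<bar>V * t\<^sup>2 / 2 - s\<^sup>2 * t\<^sup>2 / 2\<bar> * exp (- min (V * t\<^sup>2 / 2) (s\<^sup>2 * t\<^sup>2 / 2))" by (rule lip)
      \<comment> \<open>The exponent with \<open>V\<close> is off by at most
        \<open>t^2 / 2 \<le> 8\<close>.\<close>
      also have "\<dots> \<le> (t\<^sup>2 / 2) * exp (8 - s\<^sup>2 * t\<^sup>2 / 24)"
      proof (rule mult_mono)
        have "s\<^sup>2 * t\<^sup>2 \<ge> 0" by simp
        then show "exp (- min (V * t\<^sup>2 / 2) (s\<^sup>2 * t\<^sup>2 / 2)) \<le> exp (8 - s\<^sup>2 * t\<^sup>2 / 24)"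
          using Vt t2 unfolding exp_le_cancel_iff by linarith
        show "\<bar>V * t\<^sup>2 / 2 - s\<^sup>2 * t\<^sup>2 / 2\<bar> \<le> t\<^sup>2 / 2" using Vt by linarith
      qed auto
      also have "exp (8 - s\<^sup>2 * t\<^sup>2 / 24) = exp 8 * e"
        by (simp add: e_def flip: exp_add)
      also have "(t\<^sup>2 / 2) * (exp 8 * e) \<le> (2 * \<bar>t\<bar>) * (exp 8 * e)"
        using mult_right_mono[OF t4, of "\<bar>t\<bar>"]
        by (intro mult_right_mono) (auto simp: power2_eq_square e_def)
      finally show ?thesis by (simp only: mult_ac)
    qed
    moreover have "cmod (iexp ((m - \<mu>) * t) - 1) * exp (- (s\<^sup>2 * t\<^sup>2 / 2)) \<le> 1 * (\<bar>t\<bar> * e)"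
    proof -
      have "cmod (iexp ((m - \<mu>) * t) - 1) \<le> \<bar>(m - \<mu>) * t\<bar>"
        using iexp_approx1[of "(m - \<mu>) * t" 0] by simp
      also have "\<dots> \<le> 1 * \<bar>t\<bar>"
        unfolding abs_mult using mean by (intro mult_right_mono) (auto simp: m_def)
      finally show ?thesis by (simp only: mult_1) (intro mult_mono, auto simp: e_def)
    qed
    ultimately have "?L \<le> 648 * K * (\<bar>t\<bar> * e) + 2 * exp 8 * (\<bar>t\<bar> * e) + 1 * (\<bar>t\<bar> * e)"
      by linarith
    also have "\<dots> = C * (\<bar>t\<bar> * exp (- (s\<^sup>2 / 12 * t\<^sup>2 / 2)))"
      by (simp add: C_def e_def algebra_simps)
    finally show ?thesis .
  qed
  from lattice_local_limit[OF s _ _ C this, where k = k]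
  show ?thesis using s by (simp add: C_def field_simps)
qed

section \<open>The Stirling law\<close>

lemma pderiv_sum: "pderiv (sum f A) = (\<Sum>x\<in>A. pderiv (f x))"
  using higher_pderiv_sum[of 1 f A] by simp

text \<open>The value and the first two derivatives of the generating polynomial at 1 are the total
  mass and the factorial moments. The second one is the sum of \<open>p i * p j\<close> over ordered
  pairs of distinct indices, that is \<open>m^2\<close> minus the sum of the squares.\<close>

lemma bernoulli_prod_moments:
  fixes a :: "nat \<Rightarrow> real" and p :: "'i \<Rightarrow> real"
  assumes "finite I" and pgf: "\<And>x::real. (\<Sum>j\<le>N. a j * x ^ j) = (\<Prod>i\<in>I. 1 - p i + p i * x)"
  defines "m \<equiv> (\<Sum>i\<in>I. p i)"
  shows "(\<Sum>j\<le>N. a j) = 1"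
    and "(\<Sum>j\<le>N. real j * a j) = m"
    and "(\<Sum>j\<le>N. (real j - m)\<^sup>2 * a j) = (\<Sum>i\<in>I. p i * (1 - p i))"
proof -
  define A where "A = (\<Sum>j\<le>N. monom (a j) j)"
  define P where "P J = (\<Prod>i\<in>J. [:1 - p i, p i:])" for J
  have A_eq: "A = P I"
    by (rule poly_ext) (simp add: A_def P_def poly_sum poly_prod poly_monom pgf mult.commute)
  have "poly (P J) 1 = 1 \<and> poly (pderiv (P J)) 1 = (\<Sum>i\<in>J. p i) \<and>
      poly (pderiv (pderiv (P J))) 1 = (\<Sum>i\<in>J. p i)\<^sup>2 - (\<Sum>i\<in>J. (p i)\<^sup>2)" if "finite J" for J
    using that
  proof (induction J)
    case empty
    then show ?case by (simp add: P_def)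
  next
    case (insert i J)
    then have "P (insert i J) = [:1 - p i, p i:] * P J" by (simp add: P_def)
    then show ?case using insert
      by (simp add: pderiv_mult pderiv_add pderiv_smult pderiv_pCons power2_eq_square algebra_simps del: mult_pCons_left)
  qed
  from this[OF \<open>finite I\<close>] have P: "poly A 1 = 1" "poly (pderiv A) 1 = m"
    "poly (pderiv (pderiv A)) 1 = m\<^sup>2 - (\<Sum>i\<in>I. (p i)\<^sup>2)"
    by (simp_all add: A_eq m_def)
  show 0: "(\<Sum>j\<le>N. a j) = 1"
    using P(1) by (simp add: A_def poly_sum poly_monom)
  have dA: "pderiv A = (\<Sum>j\<le>N. monom (real j * a j) (j - 1))"
    by (simp add: A_def pderiv_sum pderiv_monom)
  show 1: "(\<Sum>j\<le>N. real j * a j) = m"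
    using P(2) by (simp add: dA poly_sum poly_monom)
  have "(\<Sum>j\<le>N. real (j - 1) * (real j * a j)) = m\<^sup>2 - (\<Sum>i\<in>I. (p i)\<^sup>2)"
    using P(3) by (simp add: dA pderiv_sum pderiv_monom poly_sum poly_monom)
  moreover have "(real j - m)\<^sup>2 * a j = real (j - 1) * (real j * a j) + (1 - 2 * m) * (real j * a j) + m\<^sup>2 * a j" for j
    by (cases j) (auto simp: power2_eq_square algebra_simps)
  ultimately have "(\<Sum>j\<le>N. (real j - m)\<^sup>2 * a j) = m\<^sup>2 - (\<Sum>i\<in>I. (p i)\<^sup>2) + (1 - 2 * m) * m + m\<^sup>2 * 1"
    by (simp only: sum.distrib sum_distrib_left[symmetric] 0 1)
  also have "\<dots> = m - (\<Sum>i\<in>I. (p i)\<^sup>2)" by (simp add: power2_eq_square algebra_simps)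
  also have "\<dots> = (\<Sum>i\<in>I. p i * (1 - p i))"
    by (simp add: m_def sum_subtractf power2_eq_square algebra_simps)
  finally show "(\<Sum>j\<le>N. (real j - m)\<^sup>2 * a j) = (\<Sum>i\<in>I. p i * (1 - p i))" .
qed

text \<open>With \<open>x i = n + i\<close>, each \<open>1 / x i\<close> exceeds the increment of
  \<open>ln x\<close> by at most \<open>1 / x i - 1 / x (i + 1)\<close>. Both telescope: the
  increments to \<open>ln (2 * n) - ln n = ln 2\<close>, the errors to at most \<open>1 / n\<close>,
  which the factor \<open>n\<close> turns into 1.\<close>

lemma sum_ratio_bounds:
  assumes "n \<ge> 1"
  shows "real n * ln 2 \<le> (\<Sum>i<n. real n / real (n + i))"
    and "(\<Sum>i<n. real n / real (n + i)) \<le> real n * ln 2 + 1"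
proof -
  define x where "x i = real (n + i)" for i
  have x: "x i > 0" "x (Suc i) = x i + 1" for i using assms by (auto simp: x_def)
  have l: "ln (x (Suc i)) - ln (x i) \<le> 1 / x i" "1 / x (Suc i) \<le> ln (x (Suc i)) - ln (x i)" for i
    using ln_diff_le[of "x (Suc i)" "x i"] ln_diff_le[of "x i" "x (Suc i)"] x[of i] by (auto simp: field_simps)
  have "(\<Sum>i<n. ln (x (Suc i)) - ln (x i)) = ln (x n) - ln (x 0)"
    by (rule sum_lessThan_telescope)
  also have "\<dots> = ln 2" using assms by (simp add: x_def ln_mult flip: mult_2)
  finally have tel: "(\<Sum>i<n. ln (x (Suc i)) - ln (x i)) = ln 2" .
  then have "ln 2 \<le> (\<Sum>i<n. 1 / x i)"
    using sum_mono[of "{..<n}" "\<lambda>i. ln (x (Suc i)) - ln (x i)" "\<lambda>i. 1 / x i"] l by simp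
  then have "real n * ln 2 \<le> real n * (\<Sum>i<n. 1 / x i)" by (intro mult_left_mono) auto
  then show "real n * ln 2 \<le> (\<Sum>i<n. real n / real (n + i))"
    by (simp add: sum_distrib_left x_def)
  have "(\<Sum>i<n. 1 / x i) \<le> (\<Sum>i<n. (ln (x (Suc i)) - ln (x i)) + (- (1 / x (Suc i)) - (- (1 / x i))))"
    using l by (intro sum_mono) (simp add: algebra_simps)
  also have "\<dots> = ln 2 + (- (1 / x n) - (- (1 / x 0)))"
    unfolding sum.distrib tel by (simp only: sum_lessThan_telescope[of "\<lambda>i. - (1 / x i)"])
  also have "\<dots> \<le> ln 2 + 1 / n"
    using x(1)[of n] by (simp add: x_def[of 0])
  finally have "real n * (\<Sum>i<n. 1 / x i) \<le> real n * (ln 2 + 1 / n)" by (intro mult_left_mono) auto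
  then show "(\<Sum>i<n. real n / real (n + i)) \<le> real n * ln 2 + 1"
    using assms by (simp add: sum_distrib_left x_def distrib_left)
qed

text \<open>The same telescoping with \<open>- 1 / x\<close> in place of \<open>ln x\<close>: the
  increments add up to \<open>1 / n - 1 / (2 * n)\<close>, the errors, bounded by increments of
  \<open>- 1 / x^2\<close>, to at most \<open>1 / n^2\<close>; the outer factor is now
  \<open>n^2\<close>.\<close>

lemma sum_ratio_sq_bounds:
  assumes "n \<ge> 1"
  shows "real n / 2 \<le> (\<Sum>i<n. (real n / real (n + i))\<^sup>2)"
    and "(\<Sum>i<n. (real n / real (n + i))\<^sup>2) \<le> real n / 2 + 1"
proof -
  define x where "x i = real (n + i)" for i
  have x: "x i > 0" "x (Suc i) = x i + 1" for i using assms by (auto simp: x_def)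
  have l: "- (1 / x (Suc i)) - (- (1 / x i)) \<le> 1 / (x i)\<^sup>2"
     "1 / (x i)\<^sup>2 \<le> (- (1 / x (Suc i)) - (- (1 / x i))) + (- (1 / (x (Suc i))\<^sup>2) - (- (1 / (x i)\<^sup>2)))" for i
  proof -
    show "- (1 / x (Suc i)) - (- (1 / x i)) \<le> 1 / (x i)\<^sup>2"
      using x[of i] by (simp add: field_simps power2_eq_square add_pos_pos)
    have "(- (1 / x (Suc i)) - (- (1 / x i))) + (- (1 / (x (Suc i))\<^sup>2) - (- (1 / (x i)\<^sup>2))) - 1 / (x i)\<^sup>2
      = 1 / (x i * (x i + 1)\<^sup>2)"
      using x[of i] by (simp add: divide_simps add_pos_pos) (simp add: power2_eq_square algebra_simps)
    also have "\<dots> \<ge> 0" using x[of i] by simp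
    finally show "1 / (x i)\<^sup>2 \<le> (- (1 / x (Suc i)) - (- (1 / x i))) + (- (1 / (x (Suc i))\<^sup>2) - (- (1 / (x i)\<^sup>2)))"
      by linarith
  qed
  have tel: "(\<Sum>i<n. - (1 / x (Suc i)) - (- (1 / x i))) = - (1 / x n) - (- (1 / x 0))"
    by (rule sum_lessThan_telescope[of "\<lambda>i. - (1 / x i)"])
  have tel2: "(\<Sum>i<n. - (1 / (x (Suc i))\<^sup>2) - (- (1 / (x i)\<^sup>2))) = - (1 / (x n)\<^sup>2) - (- (1 / (x 0)\<^sup>2))"
    by (rule sum_lessThan_telescope[of "\<lambda>i. - (1 / (x i)\<^sup>2)"])
  have v: "- (1 / x n) - (- (1 / x 0)) = 1 / (2 * real n)"
    using assms by (simp add: x_def field_simps)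
  have eq: "(\<Sum>i<n. (real n / real (n + i))\<^sup>2) = (real n)\<^sup>2 * (\<Sum>i<n. 1 / (x i)\<^sup>2)"
    by (simp add: sum_distrib_left x_def power_divide)
  have "1 / (2 * real n) \<le> (\<Sum>i<n. 1 / (x i)\<^sup>2)"
    unfolding v[symmetric] tel[symmetric] by (intro sum_mono l)
  then have "(real n)\<^sup>2 * (1 / (2 * real n)) \<le> (real n)\<^sup>2 * (\<Sum>i<n. 1 / (x i)\<^sup>2)"
    by (intro mult_left_mono) auto
  then show "real n / 2 \<le> (\<Sum>i<n. (real n / real (n + i))\<^sup>2)"
    unfolding eq using assms by (simp add: power2_eq_square)
  have "(\<Sum>i<n. 1 / (x i)\<^sup>2) \<le> (\<Sum>i<n. (- (1 / x (Suc i)) - (- (1 / x i))) + (- (1 / (x (Suc i))\<^sup>2) - (- (1 / (x i)\<^sup>2))))"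
    by (intro sum_mono l)
  also have "\<dots> = 1 / (2 * real n) + (- (1 / (x n)\<^sup>2) - (- (1 / (x 0)\<^sup>2)))"
    by (simp only: sum.distrib tel tel2 v)
  also have "\<dots> \<le> 1 / (2 * real n) + 1 / (real n)\<^sup>2"
    by (simp add: x_def[of 0])
  finally have "(real n)\<^sup>2 * (\<Sum>i<n. 1 / (x i)\<^sup>2) \<le> (real n)\<^sup>2 * (1 / (2 * real n) + 1 / (real n)\<^sup>2)"
    by (intro mult_left_mono) auto
  also have "\<dots> = real n / 2 + 1"
    using assms by (simp add: distrib_left power2_eq_square)
  finally show "(\<Sum>i<n. (real n / real (n + i))\<^sup>2) \<le> real n / 2 + 1"
    unfolding eq .
qed

text \<open>The law of a sum of independent Bernoulli variables with success probabilities
  \<open>n / (n + i)\<close>, \<open>i < n\<close>.\<close>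

definition stirling_law :: "nat \<Rightarrow> nat \<Rightarrow> real" where
  "stirling_law n k = real (stirling n k) * real n ^ k / pochhammer (real n) n"

lemma stirling_law_nonneg [simp]: "stirling_law n k \<ge> 0"
  by (cases "n = 0") (auto simp: stirling_law_def intro!: divide_nonneg_nonneg pochhammer_nonneg)

lemma stirling_law_0 [simp]: "n > 0 \<Longrightarrow> stirling_law n 0 = 0"
  by (simp add: stirling_law_def)

text \<open>Stated over \<open>real_field\<close> because the moments use the real instance and
  Fourier inversion the complex one.\<close>

lemma stirling_law_pgf:
  fixes z :: "'a :: real_field"
  assumes "n > 0"
  shows "(\<Sum>k\<le>n. of_real (stirling_law n k) * z ^ k) =
    (\<Prod>i<n. 1 - of_real (real n / real (n + i)) + of_real (real n / real (n + i)) * z)"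
proof -
  have "(\<Sum>k\<le>n. of_real (stirling_law n k) * z ^ k)
      = (\<Sum>k\<le>n. of_nat (stirling n k) * (of_nat n * z) ^ k) / of_real (pochhammer (real n) n)"
    by (simp add: stirling_law_def sum_divide_distrib power_mult_distrib mult_ac)
  also have "\<dots> = pochhammer (of_nat n * z) n / of_real (pochhammer (real n) n)"
    by (simp only: stirling_pochhammer)
  also have "\<dots> = (\<Prod>i<n. (of_nat n * z + of_nat i) / of_real (real n + real i))"
    by (simp add: pochhammer_prod atLeast0LessThan prod_dividef)
  also have "\<dots> = (\<Prod>i<n. 1 - of_real (real n / real (n + i)) + of_real (real n / real (n + i)) * z)"
  proof (rule prod.cong)
    fix i assume "i \<in> {..<n}"
    have "of_nat n + of_nat i \<noteq> (0::'a)" using assms by (simp flip: of_nat_add)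
    then show "(of_nat n * z + of_nat i) / of_real (real n + real i)
        = 1 - of_real (real n / real (n + i)) + of_real (real n / real (n + i)) * z"
      by (simp add: divide_simps)
  qed simp
  finally show ?thesis .
qed

section \<open>Comparison of the two laws\<close>

text \<open>As \<open>q\<close> sums to 1, the total \<open>sum w J\<close> inherits the relative
  error \<open>\<epsilon>\<close> with respect to \<open>B\<close>. Numerator and total contribute
  \<open>\<epsilon>\<close> each, and \<open>\<epsilon> \<le> 1 / 2\<close> keeps the total above
  \<open>B / 2\<close>, which doubles the sum to \<open>4 * \<epsilon>\<close>.\<close>

lemma normalized_perturbation:
  fixes w q :: "'i \<Rightarrow> real"
  assumes "finite J" "k \<in> J" and q: "\<And>j. j \<in> J \<Longrightarrow> q j \<ge> 0" "sum q J = 1"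
    and B: "B > 0" and \<epsilon>: "0 \<le> \<epsilon>" "\<epsilon> \<le> 1 / 2"
    and w: "\<And>j. j \<in> J \<Longrightarrow> \<bar>w j - B * q j\<bar> \<le> \<epsilon> * (B * q j)"
  shows "\<bar>w k / sum w J - q k\<bar> \<le> 4 * \<epsilon> * q k"
proof -
  let ?W = "sum w J"
  have "?W - B = (\<Sum>j\<in>J. w j - B * q j)"
    using q by (simp add: sum_subtractf flip: sum_distrib_left)
  also have "\<bar>\<dots>\<bar> \<le> (\<Sum>j\<in>J. \<epsilon> * (B * q j))"
    by (rule order.trans[OF sum_abs]) (intro sum_mono w)
  also have "\<dots> = \<epsilon> * B"
    using q by (simp flip: sum_distrib_left)
  finally have W: "\<bar>?W - B\<bar> \<le> \<epsilon> * B" .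
  moreover have "\<epsilon> * B \<le> 1 / 2 * B" using \<epsilon> B by (intro mult_right_mono) auto
  ultimately have W2: "?W \<ge> B / 2" by linarith
  have "\<bar>w k - q k * ?W\<bar> = \<bar>(w k - B * q k) - q k * (?W - B)\<bar>"
    by (simp add: algebra_simps)
  also have "\<dots> \<le> \<epsilon> * (B * q k) + q k * (\<epsilon> * B)"
  proof (rule order.trans[OF abs_triangle_ineq4], rule add_mono)
    show "\<bar>q k * (?W - B)\<bar> \<le> q k * (\<epsilon> * B)"
      using q(1)[OF \<open>k \<in> J\<close>] W by (simp add: abs_mult mult_left_mono)
  qed (use w \<open>k \<in> J\<close> in auto)
  also have "\<dots> = 4 * \<epsilon> * q k * (B / 2)" by simp
  also have "\<dots> \<le> 4 * \<epsilon> * q k * ?W"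
    using q(1)[OF \<open>k \<in> J\<close>] \<epsilon> W2 by (intro mult_left_mono) auto
  finally have "\<bar>(w k - q k * ?W) / ?W\<bar> \<le> 4 * \<epsilon> * q k"
    using W2 B unfolding abs_divide by (simp add: pos_divide_le_eq)
  then show ?thesis using W2 B by (simp add: diff_divide_distrib)
qed

lemma stirling_law_moments:
  assumes "n > 0"
  defines "m \<equiv> (\<Sum>i<n. real n / real (n + i))"
  shows "(\<Sum>k=1..n. stirling_law n k) = 1"
    and "(\<Sum>k=1..n. real k * stirling_law n k) = m"
    and "(\<Sum>k=1..n. (real k - m)\<^sup>2 * stirling_law n k)
      = (\<Sum>i<n. real n / real (n + i) * (1 - real n / real (n + i)))"
    and "\<bar>m - ln 2 * real n\<bar> \<le> 1"
    and "\<bar>(\<Sum>i<n. real n / real (n + i) * (1 - real n / real (n + i))) - (ln 2 - 1 / 2) * real n\<bar> \<le> 1"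
proof -
  \<comment> \<open>The mass at 0 vanishes, so the range \<open>1..n\<close> of the theorem and the
    range \<open>0..n\<close> of the generating polynomial give the same sums.\<close>
  have from1: "(\<Sum>k=1..n. f k * stirling_law n k) = (\<Sum>k\<le>n. f k * stirling_law n k)" for f :: "nat \<Rightarrow> real"
    using assms(1) by (intro sum.mono_neutral_left) (auto simp: not_le)
  note mom = bernoulli_prod_moments[OF finite_lessThan stirling_law_pgf[OF assms(1), where 'a = real, simplified of_real_eq_id id_apply]]
  show "(\<Sum>k=1..n. stirling_law n k) = 1"
    using mom(1) from1[of "\<lambda>_. 1"] by simp
  show "(\<Sum>k=1..n. real k * stirling_law n k) = m"
    using mom(2) from1[of real] by (simp add: m_def)
  show "(\<Sum>k=1..n. (real k - m)\<^sup>2 * stirling_law n k)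
      = (\<Sum>i<n. real n / real (n + i) * (1 - real n / real (n + i)))"
    unfolding from1 using mom(3) by (simp add: m_def)
  have n1: "n \<ge> 1" using assms(1) by simp
  show "\<bar>m - ln 2 * real n\<bar> \<le> 1"
    using sum_ratio_bounds[OF n1] by (simp add: m_def abs_le_iff mult.commute)
  \<comment> \<open>Both sums exceed their main terms by an amount in \<open>[0, 1]\<close>, so the
    error of their difference lies in \<open>[- 1, 1]\<close>.\<close>
  have "(\<Sum>i<n. real n / real (n + i) * (1 - real n / real (n + i))) = m - (\<Sum>i<n. (real n / real (n + i))\<^sup>2)"
    by (simp add: m_def right_diff_distrib sum_subtractf power2_eq_square)
  then show "\<bar>(\<Sum>i<n. real n / real (n + i) * (1 - real n / real (n + i))) - (ln 2 - 1 / 2) * real n\<bar> \<le> 1"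
    using sum_ratio_bounds[OF n1] sum_ratio_sq_bounds[OF n1] unfolding m_def left_diff_distrib abs_le_iff
    by (simp add: mult.commute)
qed

lemma stirling_law_local_limit:
  fixes \<sigma> :: real
  assumes \<sigma>: "\<sigma>\<^sup>2 = ln 2 - 1 / 2" "\<sigma> > 0"
  shows "\<exists>D. \<forall>n>0. \<forall>k::int. \<bar>(if 1 \<le> k \<and> k \<le> int n then stirling_law n (nat k) else 0)
     - 1 / (\<sigma> * sqrt n * sqrt (2 * pi)) * exp (- ((of_int k - ln 2 * real n)\<^sup>2 / (2 * \<sigma>\<^sup>2 * real n)))\<bar> \<le> D / n"
proof (intro exI allI impI)
  fix n :: nat and k :: int
  assume n: "n > 0"
  have sq: "(\<sigma> * sqrt n)\<^sup>2 = \<sigma>\<^sup>2 * real n" by (simp add: power_mult_distrib)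
  have "\<bar>(if 0 \<le> k \<and> k \<le> int n then stirling_law n (nat k) else 0)
     - 1 / ((\<sigma> * sqrt n) * sqrt (2 * pi)) * exp (- ((of_int k - ln 2 * real n)\<^sup>2 / (2 * (\<sigma> * sqrt n)\<^sup>2)))\<bar>
     \<le> 12 * (648 * (1 / \<sigma>\<^sup>2) + 2 * exp 8 + 1) / (pi * (\<sigma> * sqrt n)\<^sup>2)"
  proof (rule bernoulli_local_limit[OF stirling_law_pgf[OF n, where 'a = complex]])
    show "real (card {..<n}) \<le> 1 / \<sigma>\<^sup>2 * (\<sigma> * sqrt n)\<^sup>2" using \<sigma>(2) by (simp add: power_mult_distrib)
    show "\<bar>(\<Sum>i<n. real n / real (n + i) * (1 - real n / real (n + i))) - (\<sigma> * sqrt n)\<^sup>2\<bar> \<le> 1"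
      using stirling_law_moments(5)[OF n] unfolding sq \<sigma>(1) .
  qed (use n \<sigma>(2) stirling_law_moments(4)[OF n] in auto)
  moreover have "(if 0 \<le> k \<and> k \<le> int n then stirling_law n (nat k) else 0)
      = (if 1 \<le> k \<and> k \<le> int n then stirling_law n (nat k) else 0)"
    using n by (cases "k = 0") auto
  ultimately show "\<bar>(if 1 \<le> k \<and> k \<le> int n then stirling_law n (nat k) else 0)
     - 1 / (\<sigma> * sqrt n * sqrt (2 * pi)) * exp (- ((of_int k - ln 2 * real n)\<^sup>2 / (2 * \<sigma>\<^sup>2 * real n)))\<bar>
     \<le> (12 * (648 * (1 / \<sigma>\<^sup>2) + 2 * exp 8 + 1) / (pi * \<sigma>\<^sup>2)) / n"
    by (simp only: sq mult.assoc divide_divide_eq_left)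
qed

definition matsunaga_law :: "nat \<Rightarrow> nat \<Rightarrow> real" where
  "matsunaga_law n k = \<bar>matsunaga n k\<bar> * real n ^ k / (\<Sum>j=1..n. \<bar>matsunaga n j\<bar> * real n ^ j)"

lemma sum_matsunaga_law: "n \<ge> 2 \<Longrightarrow> (\<Sum>k=1..n. matsunaga_law n k) = 1"
  using matsunaga_sum_pos[of n] by (simp add: matsunaga_law_def flip: sum_divide_distrib)

lemma matsunaga_law_approx:
  "\<exists>C\<ge>0. \<forall>\<^sub>F n in at_top. \<forall>k\<in>{1..n}. \<bar>matsunaga_law n k - stirling_law n k\<bar> \<le> C / sqrt n * stirling_law n k"
proof -
  obtain C0 where C0: "\<And>n k. n \<ge> 2 \<Longrightarrow> \<bar>\<bar>matsunaga n k\<bar> - no_singleton_bell n * stirling n k\<bar>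
      \<le> C0 / sqrt n * (no_singleton_bell n * stirling n k)"
    using matsunaga_approx by blast
  define C where "C = \<bar>C0\<bar>"
  \<comment> \<open>The smallness condition of \<open>normalized_perturbation\<close> makes the
    comparison an eventual one.\<close>
  have "\<forall>\<^sub>F n :: nat in at_top. C / sqrt n \<le> 1 / 2"
  proof -
    have "(\<lambda>n::nat. C / sqrt n) \<longlonglongrightarrow> 0" by real_asymp
    then show ?thesis by (rule order_tendstoD(2)[of _ 0 _ "1 / 2", THEN eventually_mono]) auto
  qed
  then have "\<forall>\<^sub>F n in at_top. \<forall>k\<in>{1..n}. \<bar>matsunaga_law n k - stirling_law n k\<bar> \<le> 4 * C / sqrt n * stirling_law n k"
    using eventually_ge_at_top[of 2]
  proof eventually_elim
    case (elim n)
    let ?B = "no_singleton_bell n * pochhammer (real n) n"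
    have poch: "pochhammer (real n) n > 0" using elim by (intro pochhammer_pos) auto
    have "\<bar>\<bar>matsunaga n k\<bar> * real n ^ k / (\<Sum>j=1..n. \<bar>matsunaga n j\<bar> * real n ^ j) - stirling_law n k\<bar>
        \<le> 4 * (C / sqrt n) * stirling_law n k" if k: "k \<in> {1..n}" for k
    proof (rule normalized_perturbation[where B = ?B])
      show "sum (stirling_law n) {1..n} = 1" using stirling_law_moments(1)[of n] elim by simp
      show "?B > 0" using poch no_singleton_bell_pos elim by simp
      fix j assume "j \<in> {1..n}"
      have "\<bar>\<bar>matsunaga n j\<bar> - no_singleton_bell n * stirling n j\<bar> \<le> C / sqrt n * (no_singleton_bell n * stirling n j)"
        by (rule order.trans[OF C0]) (use elim in \<open>auto simp: C_def intro!: mult_right_mono divide_right_mono\<close>)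
      then have "\<bar>\<bar>matsunaga n j\<bar> - no_singleton_bell n * stirling n j\<bar> * real n ^ j
          \<le> C / sqrt n * (no_singleton_bell n * stirling n j) * real n ^ j"
        by (intro mult_right_mono) auto
      moreover have "\<bar>\<bar>matsunaga n j\<bar> - no_singleton_bell n * stirling n j\<bar> * real n ^ j
          = \<bar>\<bar>matsunaga n j\<bar> * real n ^ j - ?B * stirling_law n j\<bar>"
      proof -
        have "?B * stirling_law n j = no_singleton_bell n * stirling n j * real n ^ j"
          using poch by (simp add: stirling_law_def)
        then have "\<bar>matsunaga n j\<bar> * real n ^ j - ?B * stirling_law n j
           = (\<bar>matsunaga n j\<bar> - no_singleton_bell n * stirling n j) * real n ^ j"
          by (simp add: left_diff_distrib)
        then show ?thesis by (simp add: abs_mult)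
      qed
      moreover have "C / sqrt n * (no_singleton_bell n * stirling n j) * real n ^ j
          = C / sqrt n * (?B * stirling_law n j)"
        using poch by (simp add: stirling_law_def)
      ultimately show "\<bar>\<bar>matsunaga n j\<bar> * real n ^ j - ?B * stirling_law n j\<bar> \<le> C / sqrt n * (?B * stirling_law n j)"
        by linarith
    qed (use k elim in \<open>auto simp: C_def\<close>)
    then show ?case by (simp add: matsunaga_law_def)
  qed
  then show ?thesis by (intro exI[of _ "4 * C"]) (auto simp: C_def)
qed

text \<open>The bound \<open>2 * \<bar>x\<bar> \<le> x\<^sup>2 / r + r\<close> with \<open>r = sqrt n\<close> stands in for
  Cauchy-Schwarz.\<close>

lemma perturbed_moments:
  fixes P q :: "nat \<Rightarrow> real" and m \<delta> r v :: real
  assumes P: "sum P J = 1" and q: "sum q J = 1" "\<And>k. k \<in> J \<Longrightarrow> q k \<ge> 0"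
    and m: "(\<Sum>k\<in>J. real k * q k) = m" and v: "(\<Sum>k\<in>J. (real k - m)\<^sup>2 * q k) = v"
    and \<delta>: "\<And>k. k \<in> J \<Longrightarrow> \<bar>P k - q k\<bar> \<le> \<delta> * q k" "\<delta> \<ge> 0"
    and r: "r > 0" "v \<le> r\<^sup>2"
  defines "e \<equiv> (\<Sum>k\<in>J. real k * P k)"
  shows "\<bar>e - m\<bar> \<le> \<delta> * r" and "\<bar>(\<Sum>k\<in>J. (real k - e)\<^sup>2 * P k) - v\<bar> \<le> \<delta> * r\<^sup>2 + \<delta>\<^sup>2 * r\<^sup>2"
proof -
  \<comment> \<open>Since \<open>q\<close> is centred at \<open>m\<close>, the difference
    \<open>e - m\<close> depends on \<open>P - q\<close> only.\<close>
  have cross: "(\<Sum>k\<in>J. (real k - m) * q k) = 0"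
    using m q by (simp add: left_diff_distrib sum_subtractf flip: sum_distrib_left)
  have em: "e - m = (\<Sum>k\<in>J. (real k - m) * P k)"
    using P by (simp add: e_def left_diff_distrib sum_subtractf flip: sum_distrib_left)
  also have "\<dots> = (\<Sum>k\<in>J. (real k - m) * (P k - q k))"
    using cross by (simp add: right_diff_distrib sum_subtractf)
  also have "\<bar>\<dots>\<bar> \<le> (\<Sum>k\<in>J. \<delta> * ((real k - m)\<^sup>2 * q k / (2 * r) + r / 2 * q k))"
  proof (rule order.trans[OF sum_abs], rule sum_mono)
    fix k assume k: "k \<in> J"
    have "0 \<le> (\<bar>real k - m\<bar> - r)\<^sup>2" by simp
    then have "2 * \<bar>real k - m\<bar> * r \<le> (real k - m)\<^sup>2 + r\<^sup>2"
      by (simp add: power2_diff[of "\<bar>_\<bar>"])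
    then have "\<bar>real k - m\<bar> \<le> ((real k - m)\<^sup>2 + r\<^sup>2) / (2 * r)"
      using r by (simp add: pos_le_divide_eq mult_ac)
    also have "\<dots> = (real k - m)\<^sup>2 / (2 * r) + r / 2"
      using r by (simp add: add_divide_distrib power2_eq_square)
    finally have *: "\<bar>real k - m\<bar> \<le> (real k - m)\<^sup>2 / (2 * r) + r / 2" .
    have "\<bar>(real k - m) * (P k - q k)\<bar> \<le> ((real k - m)\<^sup>2 / (2 * r) + r / 2) * (\<delta> * q k)"
      unfolding abs_mult using * r by (intro mult_mono \<delta>(1)[OF k]) auto
    then show "\<bar>(real k - m) * (P k - q k)\<bar> \<le> \<delta> * ((real k - m)\<^sup>2 * q k / (2 * r) + r / 2 * q k)"
      by (simp add: algebra_simps)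
  qed
  also have "\<dots> = \<delta> * (v / (2 * r) + r / 2)"
    using q v by (simp add: sum.distrib flip: sum_distrib_left sum_divide_distrib)
  also have "\<dots> \<le> \<delta> * (r\<^sup>2 / (2 * r) + r / 2)"
    using r \<delta>(2) by (intro mult_left_mono add_mono divide_right_mono) auto
  also have "\<dots> = \<delta> * r" using r by (simp add: power2_eq_square)
  finally show em_le: "\<bar>e - m\<bar> \<le> \<delta> * r" .
  \<comment> \<open>Moving the centre from \<open>m\<close> to \<open>e\<close> lowers the second
    moment of \<open>P\<close> by exactly \<open>(e - m)^2\<close>.\<close>
  have "(real k - e)\<^sup>2 * P k = (real k - m)\<^sup>2 * P k - 2 * (e - m) * ((real k - m) * P k) + (e - m)\<^sup>2 * P k" for k
    by (simp add: power2_eq_square algebra_simps)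
  then have "(\<Sum>k\<in>J. (real k - e)\<^sup>2 * P k) = (\<Sum>k\<in>J. (real k - m)\<^sup>2 * P k) - 2 * (e - m) * (e - m) + (e - m)\<^sup>2 * 1"
    by (simp only: sum.distrib sum_subtractf sum_distrib_left[symmetric] P em[symmetric])
  moreover have "2 * (e - m) * (e - m) = 2 * (e - m)\<^sup>2"
    by (simp add: power2_eq_square)
  ultimately have "(\<Sum>k\<in>J. (real k - e)\<^sup>2 * P k) - v = (\<Sum>k\<in>J. (real k - m)\<^sup>2 * (P k - q k)) - (e - m)\<^sup>2"
    by (simp add: v[symmetric] right_diff_distrib[of "(_)\<^sup>2"] sum_subtractf)
  also have "\<bar>\<dots>\<bar> \<le> \<delta> * r\<^sup>2 + \<delta>\<^sup>2 * r\<^sup>2"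
  proof (rule order.trans[OF abs_triangle_ineq4], rule add_mono)
    have "\<bar>\<Sum>k\<in>J. (real k - m)\<^sup>2 * (P k - q k)\<bar> \<le> (\<Sum>k\<in>J. \<delta> * ((real k - m)\<^sup>2 * q k))"
    proof (rule order.trans[OF sum_abs], rule sum_mono)
      fix k assume k: "k \<in> J"
      have "\<bar>(real k - m)\<^sup>2 * (P k - q k)\<bar> \<le> (real k - m)\<^sup>2 * (\<delta> * q k)"
        unfolding abs_mult using \<delta>(1)[OF k] by (simp add: mult_left_mono)
      then show "\<bar>(real k - m)\<^sup>2 * (P k - q k)\<bar> \<le> \<delta> * ((real k - m)\<^sup>2 * q k)" by (simp add: mult_ac)
    qed
    also have "\<dots> = \<delta> * v" by (simp add: v flip: sum_distrib_left)
    also have "\<dots> \<le> \<delta> * r\<^sup>2" using r \<delta> by (intro mult_left_mono) auto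
    finally show "\<bar>\<Sum>k\<in>J. (real k - m)\<^sup>2 * (P k - q k)\<bar> \<le> \<delta> * r\<^sup>2" .
    show "\<bar>(e - m)\<^sup>2\<bar> \<le> \<delta>\<^sup>2 * r\<^sup>2"
      using power_mono[OF em_le, of 2] by (simp add: power_mult_distrib)
  qed
  finally show "\<bar>(\<Sum>k\<in>J. (real k - e)\<^sup>2 * P k) - v\<bar> \<le> \<delta> * r\<^sup>2 + \<delta>\<^sup>2 * r\<^sup>2" .
qed

text \<open>Point masses adding up to 1 on \<open>A\<close> force \<open>X\<close> into
  \<open>A\<close> almost surely, so \<open>f (X \<omega>)\<close> is almost surely a finite sum of
  indicators; this also settles integrability for arbitrary \<open>f\<close>.\<close>

lemma (in prob_space) expectation_finite_range:
  fixes f :: "'b \<Rightarrow> real"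
  assumes X: "X \<in> measurable M (count_space UNIV)" and A: "finite A"
    and total: "(\<Sum>k\<in>A. \<P>(\<omega> in M. X \<omega> = k)) = 1"
  shows "expectation (\<lambda>\<omega>. f (X \<omega>)) = (\<Sum>k\<in>A. f k * \<P>(\<omega> in M. X \<omega> = k))"
proof -
  have ev: "{\<omega> \<in> space M. X \<omega> = k} \<in> events" for k
    using measurable_sets[OF X, of "{k}"] by (auto simp: vimage_def Int_def conj_commute)
  have "(\<Union>k\<in>A. {\<omega> \<in> space M. X \<omega> = k}) = {\<omega> \<in> space M. X \<omega> \<in> A}" by auto
  moreover have "prob (\<Union>k\<in>A. {\<omega> \<in> space M. X \<omega> = k}) = (\<Sum>k\<in>A. \<P>(\<omega> in M. X \<omega> = k))"
    using A ev by (intro finite_measure_finite_Union) (auto simp: disjoint_family_on_def)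
  moreover have "(\<Union>k\<in>A. {\<omega> \<in> space M. X \<omega> = k}) \<in> events"
    using A ev by (intro sets.finite_UN) auto
  ultimately have AE: "AE \<omega> in M. X \<omega> \<in> A"
    using total by (simp flip: prob_Collect_eq_1)
  have "expectation (\<lambda>\<omega>. f (X \<omega>)) = expectation (\<lambda>\<omega>. \<Sum>k\<in>A. f k * indicator {\<omega> \<in> space M. X \<omega> = k} \<omega>)"
  proof (rule integral_cong_AE)
    show "(\<lambda>\<omega>. f (X \<omega>)) \<in> borel_measurable M"
      by (rule measurable_compose[OF X]) simp
    show "(\<lambda>\<omega>. \<Sum>k\<in>A. f k * indicator {\<omega> \<in> space M. X \<omega> = k} \<omega>) \<in> borel_measurable M"
      using ev by (intro borel_measurable_sum borel_measurable_times borel_measurable_indicator) auto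
    show "AE \<omega> in M. f (X \<omega>) = (\<Sum>k\<in>A. f k * indicator {\<omega> \<in> space M. X \<omega> = k} \<omega>)"
      using AE AE_space
    proof eventually_elim
      case (elim \<omega>)
      then have "(\<Sum>k\<in>A. f k * indicator {\<omega> \<in> space M. X \<omega> = k} \<omega>) = (\<Sum>k\<in>A. if k = X \<omega> then f k else 0)"
        by (intro sum.cong) (auto simp: indicator_def)
      then show ?case using elim A by simp
    qed
  qed
  also have "\<dots> = (\<Sum>k\<in>A. f k * \<P>(\<omega> in M. X \<omega> = k))"
    using ev by (subst Bochner_Integration.integral_sum) (auto simp: emeasure_eq_measure)
  finally show ?thesis .
qed

lemma asymp_equiv_sqrt_error:
  fixes f :: "nat \<Rightarrow> real" and c K :: real
  assumes "c \<noteq> 0" "\<forall>\<^sub>F n in at_top. \<bar>f n - c * real n\<bar> \<le> K * sqrt n"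
  shows "f \<sim>[at_top] (\<lambda>n. c * real n)"
proof (rule smallo_imp_asymp_equiv)
  have "(\<lambda>n. f n - c * real n) \<in> O(\<lambda>n. sqrt (real n))"
    using assms(2) by (intro bigoI[of _ K]) (auto elim!: eventually_mono)
  also have "(\<lambda>n. sqrt (real n)) \<in> o(\<lambda>n. c * real n)"
    using assms(1) by real_asymp
  finally show "(\<lambda>n. f n - c * real n) \<in> o(\<lambda>n. c * real n)" .
qed

theorem theorem3:
  fixes \<mu> \<sigma> :: real
    and \<Omega> :: "nat \<Rightarrow> 'a measure"
    and Y :: "nat \<Rightarrow> 'a \<Rightarrow> int"
  assumes mu: "\<mu> = ln 2"
    and sigma: "\<sigma>\<^sup>2 = ln 2 - 1 / 2" "\<sigma> > 0"
    and prob: "\<And>n. n \<ge> 2 \<Longrightarrow> prob_space (\<Omega> n)"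
    and rv: "\<And>n. n \<ge> 2 \<Longrightarrow> Y n \<in> measurable (\<Omega> n) (count_space UNIV)"
    and dist: "\<And>n k. n \<ge> 2 \<Longrightarrow> 1 \<le> k \<Longrightarrow> k \<le> n \<Longrightarrow>
      \<P>(\<omega> in \<Omega> n. Y n \<omega> = int k) =
        \<bar>matsunaga n k\<bar> * real n ^ k / (\<Sum>j=1..n. \<bar>matsunaga n j\<bar> * real n ^ j)"
    and dist0: "\<And>n k. n \<ge> 2 \<Longrightarrow> k \<notin> {1..int n} \<Longrightarrow> \<P>(\<omega> in \<Omega> n. Y n \<omega> = k) = 0"
  shows "(\<lambda>n. prob_space.expectation (\<Omega> n) (\<lambda>\<omega>. real_of_int (Y n \<omega>)))
           \<sim>[at_top] (\<lambda>n. \<mu> * real n) \<and>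
         (\<lambda>n. prob_space.variance (\<Omega> n) (\<lambda>\<omega>. real_of_int (Y n \<omega>)))
           \<sim>[at_top] (\<lambda>n. \<sigma>\<^sup>2 * real n) \<and>
         (\<lambda>n. SUP k :: int. \<bar>\<sigma> * sqrt (real n) * \<P>(\<omega> in \<Omega> n. Y n \<omega> = k)
            - 1 / sqrt (2 * pi) *
              exp (- ((real_of_int k - \<mu> * real n)\<^sup>2 / (2 * \<sigma>\<^sup>2 * real n)))\<bar>)
           \<in> O(\<lambda>n. real n powr (- 1 / 2))"
proof (intro conjI)
  obtain C where C: "C \<ge> 0"
    "\<forall>\<^sub>F n in at_top. \<forall>k\<in>{1..n}. \<bar>matsunaga_law n k - stirling_law n k\<bar> \<le> C / sqrt n * stirling_law n k"
    using matsunaga_law_approx by blast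
  obtain D where D: "\<And>n k. n > 0 \<Longrightarrow> \<bar>(if 1 \<le> k \<and> k \<le> int n then stirling_law n (nat k) else 0)
     - 1 / (\<sigma> * sqrt n * sqrt (2 * pi)) * exp (- ((of_int k - ln 2 * real n)\<^sup>2 / (2 * \<sigma>\<^sup>2 * real n)))\<bar> \<le> D / n"
    using stirling_law_local_limit[OF sigma] by blast
  have D0: "D \<ge> 0" using order.trans[OF abs_ge_zero D[of 1 0]] by simp
  have law: "\<P>(\<omega> in \<Omega> n. Y n \<omega> = k) = (if 1 \<le> k \<and> k \<le> int n then matsunaga_law n (nat k) else 0)"
    if "n \<ge> 2" for n k
    using dist[OF that, of "nat k"] dist0[OF that, of k] by (auto simp: matsunaga_law_def)
  have reindex: "(\<Sum>k=1..int n. g k) = (\<Sum>k=1..n. g (int k))" for g :: "int \<Rightarrow> real" and n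
    by (rule sum.reindex_bij_witness[of _ int nat]) auto
  have expect: "prob_space.expectation (\<Omega> n) (\<lambda>\<omega>. g (Y n \<omega>)) = (\<Sum>k=1..n. g (int k) * matsunaga_law n k)"
    if n: "n \<ge> 2" for n g
  proof -
    have "(\<Sum>k=1..int n. \<P>(\<omega> in \<Omega> n. Y n \<omega> = k)) = 1"
      unfolding reindex using sum_matsunaga_law[OF n] by (simp add: law[OF n])
    from prob_space.expectation_finite_range[OF prob[OF n] rv[OF n] _ this, of g]
    show ?thesis unfolding reindex by (simp add: law[OF n])
  qed
  define e where "e n = (\<Sum>k=1..n. real k * matsunaga_law n k)" for n
  \<comment> \<open>With \<open>\<delta> = C / sqrt n\<close> and \<open>r = sqrt n\<close>, the
    errors in \<open>perturbed_moments\<close> are \<open>C\<close> and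
    \<open>C * sqrt n + C^2\<close>; the extra 1 is the error of the exact Bernoulli mean and
    variance.\<close>
  have moments: "\<forall>\<^sub>F n in at_top. \<bar>e n - ln 2 * real n\<bar> \<le> (C + 1) * sqrt n \<and>
     \<bar>(\<Sum>k=1..n. (real k - e n)\<^sup>2 * matsunaga_law n k) - \<sigma>\<^sup>2 * real n\<bar> \<le> (C + C\<^sup>2 + 1) * sqrt n"
    using C(2) eventually_ge_at_top[of 2]
  proof eventually_elim
    case (elim n)
    define m where "m = (\<Sum>i<n. real n / real (n + i))"
    define v where "v = (\<Sum>i<n. real n / real (n + i) * (1 - real n / real (n + i)))"
    have n: "n > 0" using elim by simp
    note mom = stirling_law_moments[OF n, folded m_def v_def]
    have "v \<le> (\<Sum>i<n. 1)"
      unfolding v_def by (intro sum_mono mult_le_one) (use n in \<open>auto simp: divide_le_eq_1\<close>)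
    then have v: "v \<le> (sqrt n)\<^sup>2" by simp
    have \<delta>: "C / sqrt n \<ge> 0" using C(1) by simp
    have sq: "1 \<le> sqrt n" using n by simp
    have pm: "\<bar>e n - m\<bar> \<le> C / sqrt n * sqrt n"
      "\<bar>(\<Sum>k=1..n. (real k - e n)\<^sup>2 * matsunaga_law n k) - v\<bar> \<le> C / sqrt n * (sqrt n)\<^sup>2 + (C / sqrt n)\<^sup>2 * (sqrt n)\<^sup>2"
      unfolding e_def
      by (rule perturbed_moments[OF sum_matsunaga_law[OF elim(2)] mom(1) stirling_law_nonneg mom(2,3) _ \<delta> _ v];
          use elim n in simp)+
    have "C / sqrt n * sqrt n = C" using n by simp
    moreover from this have "(C / sqrt n)\<^sup>2 * (sqrt n)\<^sup>2 = C\<^sup>2"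
      by (simp only: power_mult_distrib[symmetric])
    moreover from calculation(1) have "C / sqrt n * (sqrt n)\<^sup>2 = C * sqrt n"
      by (simp only: power2_eq_square mult.assoc[symmetric])
    moreover have "C \<le> C * sqrt n" "C\<^sup>2 \<le> C\<^sup>2 * sqrt n"
      using C(1) sq by (simp_all add: mult_le_cancel_left1)
    ultimately show ?case using pm mom(4,5) sq unfolding sigma(1) distrib_right
      by linarith
  qed
  show "(\<lambda>n. prob_space.expectation (\<Omega> n) (\<lambda>\<omega>. real_of_int (Y n \<omega>))) \<sim>[at_top] (\<lambda>n. \<mu> * real n)"
  proof (rule asymp_equiv_sqrt_error)
    show "\<forall>\<^sub>F n in at_top. \<bar>prob_space.expectation (\<Omega> n) (\<lambda>\<omega>. real_of_int (Y n \<omega>)) - \<mu> * real n\<bar> \<le> (C + 1) * sqrt n"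
      using moments eventually_ge_at_top[of 2]
      by eventually_elim (use expect[of _ real_of_int] in \<open>simp add: mu e_def\<close>)
  qed (simp add: mu)
  show "(\<lambda>n. prob_space.variance (\<Omega> n) (\<lambda>\<omega>. real_of_int (Y n \<omega>))) \<sim>[at_top] (\<lambda>n. \<sigma>\<^sup>2 * real n)"
  proof (rule asymp_equiv_sqrt_error)
    show "\<forall>\<^sub>F n in at_top. \<bar>prob_space.variance (\<Omega> n) (\<lambda>\<omega>. real_of_int (Y n \<omega>)) - \<sigma>\<^sup>2 * real n\<bar> \<le> (C + C\<^sup>2 + 1) * sqrt n"
      using moments eventually_ge_at_top[of 2]
    proof eventually_elim
      case (elim n)
      have "prob_space.expectation (\<Omega> n) (\<lambda>\<omega>. real_of_int (Y n \<omega>)) = e n"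
        using expect[OF elim(2), of real_of_int] by (simp add: e_def)
      then show ?case
        using elim expect[OF elim(2), of "\<lambda>k. (real_of_int k - e n)\<^sup>2"] by simp
    qed
  qed (use sigma(2) in simp)
  \<comment> \<open>The scaled local limit error of the Stirling law is
    \<open>\<sigma> * D / sqrt n\<close>. It also gives
    \<open>?s * q \<le> 1 + \<sigma> * D\<close>, the quantity that the relative error
    \<open>C / sqrt n\<close> multiplies.\<close>
  define E where "E = C * (1 + \<sigma> * D) + \<sigma> * D"
  show "(\<lambda>n. SUP k :: int. \<bar>\<sigma> * sqrt (real n) * \<P>(\<omega> in \<Omega> n. Y n \<omega> = k)
            - 1 / sqrt (2 * pi) *
              exp (- ((real_of_int k - \<mu> * real n)\<^sup>2 / (2 * \<sigma>\<^sup>2 * real n)))\<bar>)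
           \<in> O(\<lambda>n. real n powr (- 1 / 2))"
  proof (rule bigoI[of _ E])
    show "\<forall>\<^sub>F n in at_top. norm (SUP k :: int. \<bar>\<sigma> * sqrt (real n) * \<P>(\<omega> in \<Omega> n. Y n \<omega> = k)
            - 1 / sqrt (2 * pi) *
              exp (- ((real_of_int k - \<mu> * real n)\<^sup>2 / (2 * \<sigma>\<^sup>2 * real n)))\<bar>) \<le> E * norm (real n powr (- 1 / 2))"
      using C(2) eventually_ge_at_top[of 2]
    proof eventually_elim
      case (elim n)
      define err where "err k = \<bar>\<sigma> * sqrt (real n) * \<P>(\<omega> in \<Omega> n. Y n \<omega> = k)
            - 1 / sqrt (2 * pi) * exp (- ((real_of_int k - \<mu> * real n)\<^sup>2 / (2 * \<sigma>\<^sup>2 * real n)))\<bar>" for k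
      have n: "n > 0" using elim by simp
      have sq: "1 \<le> sqrt n" using n by simp
      let ?s = "\<sigma> * sqrt n"
      have s: "?s > 0" using sigma n by simp
      have err: "err k \<le> E / sqrt n" for k
      proof -
        define g where "g = 1 / sqrt (2 * pi) * exp (- ((real_of_int k - \<mu> * real n)\<^sup>2 / (2 * \<sigma>\<^sup>2 * real n)))"
        define P where "P = \<P>(\<omega> in \<Omega> n. Y n \<omega> = k)"
        define q where "q = (if 1 \<le> k \<and> k \<le> int n then stirling_law n (nat k) else 0)"
        have "exp (- ((real_of_int k - \<mu> * real n)\<^sup>2 / (2 * \<sigma>\<^sup>2 * real n))) \<le> 1" by simp
        moreover have "sqrt (2 * pi) \<ge> 1" using pi_ge_two by (intro real_le_rsqrt) auto
        ultimately have "exp (- ((real_of_int k - \<mu> * real n)\<^sup>2 / (2 * \<sigma>\<^sup>2 * real n))) \<le> sqrt (2 * pi)"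
          by linarith
        then have g: "g \<le> 1" by (simp add: g_def)
        have "\<bar>q - g / ?s\<bar> \<le> D / n"
          using D[OF n, of k] by (simp add: q_def g_def mu mult_ac)
        then have "?s * \<bar>q - g / ?s\<bar> \<le> ?s * (D / n)"
          using s by (intro mult_left_mono) auto
        moreover have "?s * \<bar>q - g / ?s\<bar> = \<bar>?s * q - g\<bar>"
          using s n sigma(2) by (simp add: abs_mult_pos' right_diff_distrib)
        moreover have "?s * (D / n) = \<sigma> * D / sqrt n"
          using n by (simp add: field_simps)
        ultimately have qg: "\<bar>?s * q - g\<bar> \<le> \<sigma> * D / sqrt n" by simp
        also have "\<dots> \<le> \<sigma> * D"
          using divide_left_mono[of 1 "sqrt n" "\<sigma> * D"] sq sigma(2) D0 n by simp
        finally have "?s * q \<le> 1 + \<sigma> * D" using g by linarith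
        then have "C / sqrt n * (?s * q) \<le> C / sqrt n * (1 + \<sigma> * D)"
          using C(1) by (intro mult_left_mono) auto
        moreover have "\<bar>P - q\<bar> \<le> C / sqrt n * q"
        proof (cases "1 \<le> k \<and> k \<le> int n")
          case True
          then have "nat k \<in> {1..n}" by auto
          then have "\<bar>matsunaga_law n (nat k) - stirling_law n (nat k)\<bar> \<le> C / sqrt n * stirling_law n (nat k)"
            using elim(1) by blast
          then show ?thesis using True by (simp only: P_def law[OF elim(2)] q_def if_True simp_thms)
        next
          case False
          then show ?thesis by (simp only: P_def law[OF elim(2)] q_def if_False diff_self abs_zero mult_zero_right order.refl)
        qed
        then have "?s * \<bar>P - q\<bar> \<le> ?s * (C / sqrt n * q)"
          using s by (intro mult_left_mono) auto
        moreover have "?s * \<bar>P - q\<bar> = \<bar>?s * P - ?s * q\<bar>"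
          using s by (simp add: abs_mult_pos' right_diff_distrib)
        moreover have "?s * (C / sqrt n * q) = C / sqrt n * (?s * q)" by simp
        moreover have "C / sqrt n * (1 + \<sigma> * D) + \<sigma> * D / sqrt n = E / sqrt n"
          by (simp add: E_def add_divide_distrib)
        ultimately have "\<bar>?s * P - g\<bar> \<le> E / sqrt n" using qg by linarith
        then show ?thesis by (simp add: err_def P_def g_def)
      qed
      have "bdd_above (range err)" using err by (intro bdd_aboveI[of _ "E / sqrt n"]) auto
      then have "0 \<le> (SUP k. err k)" by (intro cSUP_upper2[of _ _ 0]) (auto simp: err_def)
      moreover have "(SUP k. err k) \<le> E / sqrt n" using err by (intro cSUP_least) auto
      moreover have "real n powr (- 1 / 2) = 1 / sqrt n"
        using powr_minus_divide[of "real n" "1 / 2"] by (simp add: powr_half_sqrt)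
      ultimately show ?case unfolding err_def by simp
    qed
  qed
qed

end
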